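(* Let $d\ge 2$, let $T$ be the $d$-regular rooted tree, and let $G\le \mathrm{Aut}(T)$ be a super strongly fractal branch profinite group (i.e. a closed subgroup of $\mathrm{Aut}(T)$ that is both super strongly fractal and branch) with normalized Haar measure $\mu$. Then for every $k\ge 2$, the action of a $k$-generated random subgroup of $G$ on $\partial T$ is not amenable almost surely. That is, for every $k\ge 2$ and for $\mu^k$-almost every $(g_1,\dots,g_k)\in G^k$, the action of the subgroup $\langle g_1,\dots,g_k\rangle$ on the set $\partial T$ is not amenable.
   Context: The $d$-regular rooted tree $T$ is identified with the free monoid on $X=\{1,\dots,d\}$: vertices are finite words over $X$, the root is the empty word $\emptyset$, and each vertex $v$ is adjacent to its $d$ descendants $vx$, $x\in X$. The $n$-th level $\mathcal{L}_n$ is the set of words of length $n$. The boundary $\partial T$ is the set of infinite words over $X$. For a vertex $v$, $T_v$ is the subtree rooted at $v$, which is identified with $T$ by deleting the prefix $v$. $\mathrm{Aut}(T)$ is the group of graph automorphisms of $T$ fixing the root, acting on the right; $v\cdot g$ is the image of $v$ under $g$. It also acts on $\partial T$. $\mathrm{St}(n)$ is the pointwise stabilizer of $\mathcal{L}_n$; the subgroups $\mathrm{St}(n)$, $n\ge 1$, form a basis of neighborhoods of the identity for the congruence topology, which makes $\mathrm{Aut}(T)$ a profinite group. Topological notions refer to this topology; a profinite subgroup $G\le \mathrm{Aut}(T)$ means a closed one, and it has a unique normalized Haar measure $\mu$; $\mu^k$ is the product measure on $G^k$. For $g\in\mathrm{Aut}(T)$ and a vertex $v$, the section $g|_v\in \mathrm{Aut}(T)$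 is the unique automorphism with $(vw)\cdot g=(v\cdot g)(w\cdot g|_v)$ for all words $w$. Write $\varphi_v(g)=g|_v$. For $G\le \mathrm{Aut}(T)$, put $\mathrm{St}_G(n)=\mathrm{St}(n)\cap G$. $G$ is level-transitive if it acts transitively on $\mathcal{L}_n$ for every $n\ge1$. $G$ is self-similar if $g|_v\in G$ for all $g\in G$ and all vertices $v$. $G$ is super strongly fractal if it is self-similar, level-transitive, and $\varphi_v(\mathrm{St}_G(n))=G$ for all $n\ge 1$ and $v\in\mathcal{L}_n$. The rigid vertex stabilizer $\mathrm{rist}_G(v)$ is the subgroup of elements of $G$ fixing every vertex not in $T_v$, and $\mathrm{Rist}_G(n)$ is the subgroup generated by all $\mathrm{rist}_G(v)$ with $v\in\mathcal{L}_n$. $G$ is branch if it is level-transitive and $\mathrm{Rist}_G(n)$ has finite index in $G$ for all $n\ge 1$. A $k$-generated random subgroup of $G$ is the (abstract) subgroup generated by $k$ independent Haar-random elements of $G$. An action of a group $H$ (regarded as a discrete group) on a set $Y$ is amenable if $Y$ admits an $H$-invariant mean, i.e. an $H$-invariant finitely additive probability measure defined on all subsets of $Y$. *)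

theory Defs
  imports "HOL-Probability.Probability" "HOL-Algebra.Generated_Groups"
begin

text \<open>The alphabet is a finite type \<^typ>\<open>'x\<close>, so that \<open>d = CARD('x)\<close>. Vertices are finite words
  \<^typ>\<open>'x list\<close>, boundary points are infinite words \<^typ>\<open>nat \<Rightarrow> 'x\<close>.\<close>

definition tree_adj :: "'x list \<Rightarrow> 'x list \<Rightarrow> bool" where
  "tree_adj u v \<longleftrightarrow> (\<exists>x. v = u @ [x]) \<or> (\<exists>x. u = v @ [x])"

definition level :: "nat \<Rightarrow> 'x list set" where
  "level n = {v. length v = n}"

text \<open>Automorphisms act on the right: \<open>v \<cdot> g\<close> is \<open>g v\<close>, so the product \<open>g h\<close> applies \<open>g\<close> first.\<close>

definition tree_Aut :: "('x list \<Rightarrow> 'x list) monoid" where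
  "tree_Aut = \<lparr> carrier = {g. bij g \<and> g [] = [] \<and> (\<forall>u v. tree_adj (g u) (g v) \<longleftrightarrow> tree_adj u v)},
     mult = (\<lambda>g h. h \<circ> g), one = id \<rparr>"

definition level_stab :: "nat \<Rightarrow> ('x list \<Rightarrow> 'x list) set" where
  "level_stab n = {g \<in> carrier tree_Aut. \<forall>v \<in> level n. g v = v}"

definition congruence_topology :: "('x list \<Rightarrow> 'x list) topology" where
  "congruence_topology = topology_generated_by
     {level_stab n #>\<^bsub>tree_Aut\<^esub> g | n g. n \<ge> 1 \<and> g \<in> carrier tree_Aut}"

definition sect :: "('x list \<Rightarrow> 'x list) \<Rightarrow> 'x list \<Rightarrow> ('x list \<Rightarrow> 'x list)" where
  "sect g v = (THE h. h \<in> carrier tree_Aut \<and> (\<forall>w. g (v @ w) = g v @ h w))"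

definition level_transitive :: "('x list \<Rightarrow> 'x list) set \<Rightarrow> bool" where
  "level_transitive G \<longleftrightarrow> (\<forall>n\<ge>1. \<forall>u \<in> level n. \<forall>v \<in> level n. \<exists>g \<in> G. g u = v)"

definition self_similar :: "('x list \<Rightarrow> 'x list) set \<Rightarrow> bool" where
  "self_similar G \<longleftrightarrow> (\<forall>g \<in> G. \<forall>v. sect g v \<in> G)"

definition super_strongly_fractal :: "('x list \<Rightarrow> 'x list) set \<Rightarrow> bool" where
  "super_strongly_fractal G \<longleftrightarrow> self_similar G \<and> level_transitive G \<and>
     (\<forall>n\<ge>1. \<forall>v \<in> level n. (\<lambda>g. sect g v) ` (level_stab n \<inter> G) = G)"

definition subtree :: "'x list \<Rightarrow> 'x list set" where
  "subtree v = range (\<lambda>w. v @ w)"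

definition rist :: "('x list \<Rightarrow> 'x list) set \<Rightarrow> 'x list \<Rightarrow> ('x list \<Rightarrow> 'x list) set" where
  "rist G v = {g \<in> G. \<forall>u. u \<notin> subtree v \<longrightarrow> g u = u}"

definition Rist :: "('x list \<Rightarrow> 'x list) set \<Rightarrow> nat \<Rightarrow> ('x list \<Rightarrow> 'x list) set" where
  "Rist G n = generate tree_Aut (\<Union>v \<in> level n. rist G v)"

definition branch :: "('x list \<Rightarrow> 'x list) set \<Rightarrow> bool" where
  "branch G \<longleftrightarrow> level_transitive G \<and>
     (\<forall>n\<ge>1. finite (rcosets\<^bsub>tree_Aut\<lparr>carrier := G\<rparr>\<^esub> (Rist G n)))"

definition normalized_Haar ::
    "('x list \<Rightarrow> 'x list) set \<Rightarrow> ('x list \<Rightarrow> 'x list) measure \<Rightarrow> bool" where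
  "normalized_Haar G \<mu> \<longleftrightarrow>
     space \<mu> = G \<and>
     sets \<mu> = sigma_sets G {U. openin (subtopology congruence_topology G) U} \<and>
     emeasure \<mu> G = 1 \<and>
     (\<forall>g \<in> G. \<forall>A \<in> sets \<mu>. emeasure \<mu> (g <#\<^bsub>tree_Aut\<^esub> A) = emeasure \<mu> A)"

text \<open>The \<open>n\<close>-th letter of the image of \<open>\<xi>\<close> is the last letter of the image of the prefix of \<open>\<xi>\<close>
  of length \<open>n + 1\<close>.\<close>

definition boundary_act :: "('x list \<Rightarrow> 'x list) \<Rightarrow> (nat \<Rightarrow> 'x) \<Rightarrow> (nat \<Rightarrow> 'x)" where
  "boundary_act g \<xi> = (\<lambda>n. g (map \<xi> [0..<Suc n]) ! n)"

definition amenable_action :: "'h set \<Rightarrow> ('h \<Rightarrow> 'y \<Rightarrow> 'y) \<Rightarrow> 'y set \<Rightarrow> bool" where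
  "amenable_action H act Y \<longleftrightarrow> (\<exists>m :: 'y set \<Rightarrow> real.
     (\<forall>A \<subseteq> Y. m A \<ge> 0) \<and> m Y = 1 \<and>
     (\<forall>A B. A \<subseteq> Y \<longrightarrow> B \<subseteq> Y \<longrightarrow> A \<inter> B = {} \<longrightarrow> m (A \<union> B) = m A + m B) \<and>
     (\<forall>h \<in> H. \<forall>A \<subseteq> Y. m (act h ` A) = m A))"

end

theory Submission
  imports Defs
begin

text \<open>The proof splits into a statement about the orbital graph of the boundary action and a
  probability estimate.

  Draw, for each generator \<open>g\<^sub>i\<close> and each boundary point \<open>\<xi>\<close>, an edge from \<open>\<xi>\<close> to \<open>\<xi> \<cdot> g\<^sub>i\<close>. If every
  edge of this graph is a bridge, the graph is a forest, and choosing a root in each component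
  orients every edge towards the root so that each point has at most one outgoing edge. The points
  are thereby sorted into disjoint classes, two for each generator, and for each generator the two
  classes together carry mass at least 1 under any invariant mean. Two generators then need
  mass 2, so there is no invariant mean (\<open>bridges_no_invariant_mean\<close>).

  It remains to see that almost surely every edge is a bridge. Fix a generator \<open>g\<^sub>i\<close> and a word \<open>q\<close>.
  If \<open>q\<close> leads from \<open>\<xi> \<cdot> g\<^sub>i\<close> back to \<open>\<xi>\<close> without traversing the edge \<open>(i, \<xi>)\<close>, then already at some
  level the prefix \<open>v\<close> of \<open>\<xi>\<close> has this property with respect to the edge \<open>(i, v)\<close>
  (\<open>boundary_cycle_closes\<close>). So there are countably many events to exclude, indexed by \<open>i\<close>, \<open>q\<close>
  and \<open>v\<close>. The section of \<open>g\<^sub>i\<close> at \<open>v\<close> occurs only once, as a first factor, in the section at \<open>v\<close> of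
  the closed walk. Multiplying \<open>g\<^sub>i\<close> by elements of the rigid stabilizer of \<open>v\<close> rerandomizes that
  factor and changes nothing else (\<open>avoids_perturb\<close>). In a branch group that is super strongly
  fractal, the sections at \<open>v\<close> of the rigid stabilizer form a subgroup of finite index in \<open>G\<close>
  (\<open>rist_sections_bounded_index\<close>). Hence the event has probability at most a constant times the
  probability that an element of \<open>G\<close> fixes a vertex of level \<open>N\<close>, for every \<open>N\<close>
  (\<open>card_closes_le\<close>).

  That probability tends to 0 (\<open>fix_prob_tendsto_0\<close>). The number \<open>X\<^sub>n\<close> of fixed vertices of level \<open>n\<close>
  has mean 1 by transitivity and is a martingale, because fractality makes the section at a fixed
  vertex uniformly distributed and independent of the action on level \<open>n\<close>. The mean of \<open>\<surd>X\<^sub>n\<close>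
  therefore decreases, and it drops by a definite amount whenever \<open>0 < X\<^sub>n \<le> c\<close>, since with definite
  probability some section is trivial on the next \<open>m\<close> levels and \<open>X\<close> jumps far above \<open>c\<close>. So
  \<open>0 < X\<^sub>n \<le> c\<close> becomes unlikely, while \<open>X\<^sub>n > c\<close> has probability at most \<open>1 / c\<close>.

  All averages are finite sums over the images of \<open>G\<close> acting on a finite level. Haar measure enters
  only through the fact that events visible on a finite level have their counting probability
  (\<open>prob_level_event\<close>).\<close>

section \<open>Tree automorphisms, sections and truncations\<close>

abbreviation Aut :: "('x list \<Rightarrow> 'x list) set" where
  "Aut \<equiv> carrier tree_Aut"

abbreviation finv :: "('a \<Rightarrow> 'b) \<Rightarrow> 'b \<Rightarrow> 'a" where
  "finv \<equiv> inv_into UNIV"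

text \<open>An explicit formula for \<^const>\<open>sect\<close>, from which sections of products and of truncations can be
  computed without appeal to uniqueness.\<close>

definition section_at :: "('x list \<Rightarrow> 'x list) \<Rightarrow> 'x list \<Rightarrow> 'x list \<Rightarrow> 'x list" where
  "section_at g v w = drop (length v) (g (v @ w))"

text \<open>The finitary automorphism that copies \<open>g\<close> on the first \<open>n\<close> letters and leaves all later letters
  alone. It represents the coset of \<open>g\<close> modulo the stabilizer of level \<open>n\<close>, so that the
  congruence quotients are again groups of tree automorphisms.\<close>

definition trunc :: "nat \<Rightarrow> ('x list \<Rightarrow> 'x list) \<Rightarrow> 'x list \<Rightarrow> 'x list" where
  "trunc n g w = g (take n w) @ drop n w"

lemma mult_tree_Aut [simp]: "g \<otimes>\<^bsub>tree_Aut\<^esub> h = h \<circ> g"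
  by (simp add: tree_Aut_def)

lemma one_tree_Aut [simp]: "\<one>\<^bsub>tree_Aut\<^esub> = id"
  by (simp add: tree_Aut_def)

lemma Aut_adj: "g \<in> Aut \<Longrightarrow> tree_adj (g u) (g v) \<longleftrightarrow> tree_adj u v"
  by (simp add: tree_Aut_def)

text \<open>The image of a child of \<open>w\<close> is adjacent to the image of \<open>w\<close>. It cannot be the parent of
  that image, because by induction the parent is already the image of the parent of \<open>w\<close>.\<close>

lemma Aut_snoc:
  assumes g: "g \<in> Aut"
  shows "\<exists>y. g (w @ [x]) = g w @ [y]"
proof (induction w arbitrary: x rule: rev_induct)
  case Nil
  have "tree_adj (g []) (g [x])"
    using g by (subst Aut_adj) (simp_all add: tree_adj_def)
  moreover have "g [] = []" using g by (simp add: tree_Aut_def)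
  ultimately show ?case by (auto simp: tree_adj_def)
next
  case (snoc z w)
  have inj: "inj g" using g by (simp add: tree_Aut_def bij_def)
  have "tree_adj (g (w @ [z])) (g ((w @ [z]) @ [x]))"
    using g by (subst Aut_adj) (simp_all add: tree_adj_def)
  then consider y where "g ((w @ [z]) @ [x]) = g (w @ [z]) @ [y]"
    | y where "g (w @ [z]) = g ((w @ [z]) @ [x]) @ [y]"
    by (auto simp: tree_adj_def)
  then show ?case
  proof cases
    case 2
    obtain y' where "g (w @ [z]) = g w @ [y']" using snoc.IH by blast
    with 2 have "g ((w @ [z]) @ [x]) = g w" by simp
    then show ?thesis using injD[OF inj] by fastforce
  qed auto
qed

lemma Aut_length [simp]: "g \<in> Aut \<Longrightarrow> length (g w) = length w"
proof (induction w rule: rev_induct)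
  case Nil
  then show ?case by (simp add: tree_Aut_def)
next
  case (snoc x xs)
  then show ?case using Aut_snoc[of g xs x] by auto
qed

lemma Aut_append:
  assumes "g \<in> Aut"
  shows "g (v @ w) = g v @ section_at g v w"
proof -
  have "\<exists>u. g (v @ w) = g v @ u"
  proof (induction w rule: rev_induct)
    case (snoc x xs)
    then obtain u where "g (v @ xs) = g v @ u" by auto
    then show ?case using Aut_snoc[OF assms, of "v @ xs" x] by auto
  qed simp
  then show ?thesis using assms by (auto simp: section_at_def)
qed

lemma Aut_bij: "g \<in> Aut \<Longrightarrow> bij g"
  by (simp add: tree_Aut_def)

lemma Aut_inj: "g \<in> Aut \<Longrightarrow> g u = g v \<longleftrightarrow> u = v"
  using Aut_bij by (metis bij_pointE)

lemma AutI:
  fixes g :: "'x list \<Rightarrow> 'x list"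
  assumes bij: "bij g" and len: "\<And>w. length (g w) = length w"
    and app: "\<And>v w. \<exists>u. g (v @ w) = g v @ u"
  shows "g \<in> Aut"
proof -
  have snoc: "\<exists>y. g (w @ [x]) = g w @ [y]" for w x
  proof -
    obtain u where "g (w @ [x]) = g w @ u" using app by blast
    moreover from this have "length u = 1" using len[of "w @ [x]"] len[of w] by simp
    ultimately show ?thesis by (auto simp: length_Suc_conv)
  qed
  have fwd: "tree_adj (g u) (g v)" if "tree_adj u v" for u v
    using that snoc unfolding tree_adj_def by metis
  have bwd: "\<exists>x. v = u @ [x]" if h: "g v = g u @ [y]" for u v y
  proof -
    have lv: "length v = Suc (length u)" using len[of v] len[of u] h by simp
    then have "v \<noteq> []" by auto
    then have v: "v = butlast v @ [last v]" by simp
    obtain y' where "g (butlast v @ [last v]) = g (butlast v) @ [y']" using snoc by blast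
    with h v have "g (butlast v) = g u" by simp
    then have "butlast v = u" using bij by (simp add: bij_def inj_eq)
    with v show ?thesis by metis
  qed
  have "tree_adj (g u) (g v) \<longleftrightarrow> tree_adj u v" for u v
    using fwd bwd unfolding tree_adj_def by metis
  moreover have "g [] = []" using len[of "[]"] by simp
  ultimately show ?thesis using bij by (simp add: tree_Aut_def)
qed

lemma id_in_Aut [simp]: "id \<in> Aut"
  by (rule AutI) auto

lemma comp_in_Aut [simp]:
  assumes "g \<in> Aut" "h \<in> Aut"
  shows "h \<circ> g \<in> Aut"
proof (rule AutI)
  show "bij (h \<circ> g)" using assms by (simp add: Aut_bij bij_comp)
  show "\<exists>u. (h \<circ> g) (v @ w) = (h \<circ> g) v @ u" for v w
    using assms by (simp add: Aut_append)
qed (use assms in simp)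

lemma inv_in_Aut [simp]:
  assumes g: "g \<in> Aut"
  shows "finv g \<in> Aut"
proof (rule AutI)
  have surj: "g (finv g w) = w" for w using Aut_bij[OF g] by (simp add: bij_is_surj surj_f_inv_f)
  show "bij (finv g)" using Aut_bij[OF g] by (rule bij_imp_bij_inv)
  show len: "length (finv g w) = length w" for w
    using surj[of w] Aut_length[OF g, of "finv g w"] by simp
  show "\<exists>u. finv g (v @ w) = finv g v @ u" for v w
  proof -
    define a where "a = take (length v) (finv g (v @ w))"
    define b where "b = drop (length v) (finv g (v @ w))"
    have ab: "finv g (v @ w) = a @ b" by (simp add: a_def b_def)
    have la: "length a = length v" by (simp add: a_def len)
    have "g a @ section_at g a b = v @ w" using surj[of "v @ w"] ab Aut_append[OF g] by metis
    then have "g a = v" using la g by simp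
    then have "a = finv g v" using Aut_bij[OF g] by (metis bij_inv_eq_iff)
    with ab show ?thesis by metis
  qed
qed

lemma Aut_inv_apply [simp]: "g \<in> Aut \<Longrightarrow> finv g (g w) = w" "g \<in> Aut \<Longrightarrow> g (finv g w) = w"
  by (simp_all add: Aut_bij bij_is_inj bij_is_surj surj_f_inv_f)

lemma Aut_inv_comp [simp]: "g \<in> Aut \<Longrightarrow> finv g \<circ> g = id" "g \<in> Aut \<Longrightarrow> g \<circ> finv g = id"
  by (auto simp: fun_eq_iff)

lemma group_tree_Aut: "group tree_Aut"
proof (rule groupI)
  fix x :: "'x list \<Rightarrow> 'x list" assume "x \<in> Aut"
  then show "\<exists>y\<in>Aut. y \<otimes>\<^bsub>tree_Aut\<^esub> x = \<one>\<^bsub>tree_Aut\<^esub>"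
    by (intro bexI[of _ "finv x"]) auto
qed (auto simp: comp_assoc)

lemma m_inv_tree_Aut: "g \<in> Aut \<Longrightarrow> inv\<^bsub>tree_Aut\<^esub> g = finv g"
  by (rule group.inv_equality[OF group_tree_Aut]) auto

lemma section_length [simp]: "g \<in> Aut \<Longrightarrow> length (section_at g v w) = length w"
  by (simp add: section_at_def)

lemma section_in_Aut [simp]:
  assumes g: "g \<in> Aut"
  shows "section_at g v \<in> Aut"
proof (rule AutI)
  have "section_at (finv g) (g v) (section_at g v w) = w" for w
    using Aut_append[OF g, of v w] g by (simp add: section_at_def)
  moreover have "section_at g v (section_at (finv g) (g v) w) = w" for w
    using Aut_append[OF inv_in_Aut[OF g], of "g v" w] g by (simp add: section_at_def)
  ultimately show "bij (section_at g v)" by (metis bijI')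
  show "length (section_at g v w) = length w" for w using g by simp
  show "\<exists>u. section_at g v (w @ w') = section_at g v w @ u" for w w'
  proof
    show "section_at g v (w @ w') = section_at g v w @ section_at g (v @ w) w'"
      using Aut_append[OF g, of "v @ w" w'] g by (simp add: section_at_def[of g v])
  qed
qed

lemma sect_eq_section:
  assumes g: "g \<in> Aut"
  shows "sect g v = section_at g v"
  unfolding sect_def
proof (rule the_equality)
  show "section_at g v \<in> Aut \<and> (\<forall>w. g (v @ w) = g v @ section_at g v w)"
    using g Aut_append by auto
  show "h = section_at g v" if "h \<in> Aut \<and> (\<forall>w. g (v @ w) = g v @ h w)" for h
    using that Aut_append[OF g] by auto
qed

lemma section_comp: "g \<in> Aut \<Longrightarrow> section_at (h \<circ> g) v = section_at h (g v) \<circ> section_at g v"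
  by (auto simp: fun_eq_iff section_at_def[of "h \<circ> g"] section_at_def[of h] Aut_append)

lemma section_id [simp]: "section_at id v = id"
  by (auto simp: section_at_def)

lemma trunc_in_Aut [simp]:
  assumes g: "g \<in> Aut"
  shows "trunc n g \<in> Aut"
proof (rule AutI)
  have inverse: "trunc n (finv h) (trunc n h w) = w" if "h \<in> Aut" for h and w :: "'a list"
    using that by (cases "length w \<le> n") (auto simp: trunc_def)
  have "trunc n g (trunc n (finv g) w) = w" for w
    using inverse[of "finv g"] g by (simp add: inv_inv_eq Aut_bij)
  with inverse[OF g] show "bij (trunc n g)" by (metis bijI')
  show "length (trunc n g w) = length w" for w using g by (simp add: trunc_def)
  show "\<exists>u. trunc n g (v @ w) = trunc n g v @ u" for v w
    using g by (cases "length v \<le> n") (auto simp: trunc_def Aut_append)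
qed

lemma trunc_short: "length w \<le> n \<Longrightarrow> trunc n g w = g w"
  by (simp add: trunc_def)

lemma trunc_comp: "g \<in> Aut \<Longrightarrow> trunc n (h \<circ> g) = trunc n h \<circ> trunc n g"
proof
  fix w assume "g \<in> Aut"
  then show "trunc n (h \<circ> g) w = (trunc n h \<circ> trunc n g) w"
    by (cases "length w \<le> n") (auto simp: trunc_def)
qed

lemma trunc_id [simp]: "trunc n id = id"
  by (auto simp: trunc_def)

lemma trunc_finv:
  assumes g: "g \<in> Aut"
  shows "finv (trunc n g) = trunc n (finv g)"
proof (rule inv_equality)
  show "trunc n (finv g) (trunc n g w) = w" for w
    using fun_cong[OF trunc_comp[OF g, of n "finv g"], of w] g by simp
  show "trunc n g (trunc n (finv g) w) = w" for w
    using fun_cong[OF trunc_comp[of "finv g" n g], of w] g by simp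
qed

lemma section_trunc:
  "g \<in> Aut \<Longrightarrow> length v = n \<Longrightarrow> section_at (trunc (n + m) g) v = trunc m (section_at g v)"
  by (auto simp: fun_eq_iff section_at_def trunc_def)

lemma trunc_eqI:
  assumes "g \<in> Aut" "h \<in> Aut" and eq: "\<And>w. length w = n \<Longrightarrow> g w = h w"
  shows "trunc n g = trunc n h"
proof
  fix w :: "'a list"
  show "trunc n g w = trunc n h w"
  proof (cases "length w \<le> n")
    case True
    define r :: "'a list" where "r = replicate (n - length w) undefined"
    have "g (w @ r) = h (w @ r)" using True by (intro eq) (simp add: r_def)
    then have "g w @ section_at g w r = h w @ section_at h w r"
      by (simp only: Aut_append[OF assms(1)] Aut_append[OF assms(2)])
    then have "g w = h w" using assms(1,2) by simp
    then show ?thesis using True by (simp add: trunc_short)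
  next
    case False
    then show ?thesis using eq[of "take n w"] by (simp add: trunc_def)
  qed
qed

lemma trunc_trunc [simp]: "trunc n (trunc (n + m) g) = trunc n g"
  by (auto simp: fun_eq_iff trunc_def min_def)

section \<open>Averages over the congruence quotients\<close>

text \<open>The quotient of \<open>G\<close> by its \<open>n\<close>-th level stabilizer, realized by the truncations of its elements.\<close>

definition level_quotient :: "('x list \<Rightarrow> 'x list) set \<Rightarrow> nat \<Rightarrow> ('x list \<Rightarrow> 'x list) set" where
  "level_quotient G n = trunc n ` G"

definition avg :: "('x list \<Rightarrow> 'x list) set \<Rightarrow> nat \<Rightarrow> (('x list \<Rightarrow> 'x list) \<Rightarrow> real) \<Rightarrow> real" where
  "avg G n f = (\<Sum>p\<in>level_quotient G n. f p) / card (level_quotient G n)"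

definition num_fixed :: "nat \<Rightarrow> ('x list \<Rightarrow> 'x list) \<Rightarrow> nat" where
  "num_fixed n p = card {w. length w = n \<and> p w = w}"

definition level_fun :: "nat \<Rightarrow> (('x list \<Rightarrow> 'x list) \<Rightarrow> real) \<Rightarrow> bool" where
  "level_fun n f \<longleftrightarrow> (\<forall>p q. (\<forall>w. length w = n \<longrightarrow> p w = q w) \<longrightarrow> f p = f q)"

lemma finite_words [simp]: "finite {w :: 'x::finite list. length w = n}"
  using finite_lists_length_eq[of "UNIV :: 'x set" n] by simp

lemma card_words: "card {w :: 'x::finite list. length w = n} = CARD('x) ^ n"
  using card_lists_length_eq[of "UNIV :: 'x set" n] by simp

lemma finite_fixed_words [simp]: "finite {w :: 'x::finite list. length w = n \<and> P w}"
  by (rule finite_subset[OF _ finite_words[of n]]) auto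

lemma finite_trunc_image:
  fixes A :: "('x::finite list \<Rightarrow> 'x list) set"
  assumes "A \<subseteq> Aut"
  shows "finite (trunc n ` A)"
proof -
  define W where "W = {w :: 'x list. length w = n}"
  have "inj_on (\<lambda>g. restrict g W) (trunc n ` A)"
  proof (rule inj_onI)
    fix p q assume "p \<in> trunc n ` A" "q \<in> trunc n ` A" and eq: "restrict p W = restrict q W"
    then obtain g h where g: "g \<in> A" "p = trunc n g" and h: "h \<in> A" "q = trunc n h" by auto
    have "g w = h w" if "length w = n" for w
      using fun_cong[OF eq, of w] that by (simp add: g h W_def trunc_short)
    then show "p = q" unfolding g h using g h assms by (intro trunc_eqI) auto
  qed
  moreover have "(\<lambda>g. restrict g W) ` trunc n ` A \<subseteq> W \<rightarrow>\<^sub>E W"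
    using assms by (auto simp: W_def restrict_PiE_iff subset_iff split: if_splits)
  then have "finite ((\<lambda>g. restrict g W) ` trunc n ` A)"
    by (rule finite_subset) (auto simp: W_def intro: finite_PiE)
  ultimately show ?thesis by (metis finite_imageD)
qed

text \<open>If translations of \<open>A\<close> that do not affect \<open>f\<close> can move \<open>\<phi>\<close> by an arbitrary element of the finite
  group \<open>B\<close>, then \<open>\<phi>\<close> is uniformly distributed on \<open>B\<close> and independent of \<open>f\<close>: averaging over all
  these translations replaces \<open>F (\<phi> p)\<close> by its mean over \<open>B\<close>.\<close>

lemma sum_product_of_equivariant:
  fixes F :: "('a \<Rightarrow> 'a) \<Rightarrow> real" and f :: "'b \<Rightarrow> real"
  assumes tr: "\<And>t. t \<in> B \<Longrightarrow> \<exists>\<sigma>. bij_betw \<sigma> A A \<and> (\<forall>p\<in>A. f (\<sigma> p) = f p \<and> \<phi> (\<sigma> p) = \<phi> p \<circ> t)"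
    and B: "\<And>p. p \<in> A \<Longrightarrow> bij_betw (\<lambda>t. \<phi> p \<circ> t) B B"
  shows "(\<Sum>p\<in>A. f p * F (\<phi> p)) * card B = (\<Sum>p\<in>A. f p) * (\<Sum>t\<in>B. F t)"
proof -
  have "(\<Sum>p\<in>A. f p * F (\<phi> p)) = (\<Sum>p\<in>A. f p * F (\<phi> p \<circ> t))" if t: "t \<in> B" for t
  proof -
    obtain \<sigma> where \<sigma>: "bij_betw \<sigma> A A"
      and "\<And>p. p \<in> A \<Longrightarrow> f (\<sigma> p) = f p \<and> \<phi> (\<sigma> p) = \<phi> p \<circ> t"
      using tr[OF t] by blast
    then show ?thesis
      by (subst sum.reindex_bij_betw[OF \<sigma>, symmetric]) (auto intro: sum.cong)
  qed
  then have "(\<Sum>t\<in>B. \<Sum>p\<in>A. f p * F (\<phi> p)) = (\<Sum>t\<in>B. \<Sum>p\<in>A. f p * F (\<phi> p \<circ> t))"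
    by (rule sum.cong[OF refl])
  also have "\<dots> = (\<Sum>p\<in>A. \<Sum>t\<in>B. f p * F (\<phi> p \<circ> t))" by (rule sum.swap)
  also have "\<dots> = (\<Sum>p\<in>A. f p * (\<Sum>t\<in>B. F t))"
    by (intro sum.cong refl)
      (simp add: sum_distrib_left[symmetric] sum.reindex_bij_betw[OF B, of _ F])
  finally show ?thesis by (simp add: sum_distrib_right mult.commute)
qed

locale tree_group =
  fixes G :: "('x::finite list \<Rightarrow> 'x list) set"
  assumes subgroup_G: "subgroup G tree_Aut"
begin

lemma G_Aut: "g \<in> G \<Longrightarrow> g \<in> Aut"
  using subgroup.subset[OF subgroup_G] by auto

lemma G_id [simp]: "id \<in> G"
  using subgroup.one_closed[OF subgroup_G] by simp

lemma G_comp: "g \<in> G \<Longrightarrow> h \<in> G \<Longrightarrow> h \<circ> g \<in> G"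
  using subgroup.m_closed[OF subgroup_G, of g h] by simp

lemma G_inv: "g \<in> G \<Longrightarrow> finv g \<in> G"
  using subgroup.m_inv_closed[OF subgroup_G, of g] by (simp add: m_inv_tree_Aut G_Aut)

lemma level_quotient_Aut: "p \<in> level_quotient G n \<Longrightarrow> p \<in> Aut"
  by (auto simp: level_quotient_def G_Aut)

lemma level_quotient_id [simp]: "id \<in> level_quotient G n"
  unfolding level_quotient_def by (rule image_eqI[of _ _ id]) auto

lemma level_quotient_comp: "p \<in> level_quotient G n \<Longrightarrow> q \<in> level_quotient G n \<Longrightarrow> q \<circ> p \<in> level_quotient G n"
  unfolding level_quotient_def by (auto simp: trunc_comp[symmetric] G_Aut intro!: imageI G_comp)

lemma level_quotient_inv: "p \<in> level_quotient G n \<Longrightarrow> finv p \<in> level_quotient G n"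
  unfolding level_quotient_def by (auto simp: trunc_finv G_Aut intro!: imageI G_inv)

lemma finite_level_quotient [simp]: "finite (level_quotient G n)"
  unfolding level_quotient_def by (rule finite_trunc_image) (auto simp: G_Aut)

lemma level_quotient_nonempty [simp]: "level_quotient G n \<noteq> {}"
  using level_quotient_id[of n] by blast

lemma trunc_level_quotient: "p \<in> level_quotient G (n + m) \<Longrightarrow> trunc n p \<in> level_quotient G n"
  by (auto simp: level_quotient_def)

lemma level_quotient_bij_comp_left: "q \<in> level_quotient G n \<Longrightarrow> bij_betw (\<lambda>t. q \<circ> t) (level_quotient G n) (level_quotient G n)"
  by (rule bij_betwI[where g = "\<lambda>t. finv q \<circ> t"])
    (auto simp: level_quotient_comp level_quotient_inv level_quotient_Aut comp_assoc[symmetric])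

lemma level_quotient_bij_comp_right: "q \<in> level_quotient G n \<Longrightarrow> bij_betw (\<lambda>t. t \<circ> q) (level_quotient G n) (level_quotient G n)"
  by (rule bij_betwI[where g = "\<lambda>t. t \<circ> finv q"])
    (auto simp: level_quotient_comp level_quotient_inv level_quotient_Aut comp_assoc)

lemma avg_cong: "(\<And>p. p \<in> level_quotient G n \<Longrightarrow> f p = g p) \<Longrightarrow> avg G n f = avg G n g"
  by (simp add: avg_def)

lemma avg_mono: "(\<And>p. p \<in> level_quotient G n \<Longrightarrow> f p \<le> g p) \<Longrightarrow> avg G n f \<le> avg G n g"
  unfolding avg_def by (intro divide_right_mono sum_mono) auto

lemma avg_add: "avg G n (\<lambda>p. f p + g p) = avg G n f + avg G n g"
  by (simp add: avg_def sum.distrib add_divide_distrib)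

lemma avg_diff: "avg G n (\<lambda>p. f p - g p) = avg G n f - avg G n g"
  by (simp add: avg_def sum_subtractf diff_divide_distrib)

lemma avg_cmult: "avg G n (\<lambda>p. c * f p) = c * avg G n f"
  by (simp add: avg_def sum_distrib_left[symmetric])

lemma avg_sum: "avg G n (\<lambda>p. \<Sum>v\<in>V. f v p) = (\<Sum>v\<in>V. avg G n (f v))"
  unfolding avg_def by (subst sum.swap) (simp add: sum_divide_distrib)

lemma avg_nonneg: "(\<And>p. p \<in> level_quotient G n \<Longrightarrow> 0 \<le> f p) \<Longrightarrow> 0 \<le> avg G n f"
  unfolding avg_def by (intro divide_nonneg_nonneg sum_nonneg) auto

text \<open>The projection between congruence quotients has fibres of equal size, so averages do not depend
  on the level at which they are computed.\<close>

lemma avg_level_fun: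
  assumes f: "level_fun n f"
  shows "avg G (n + m) f = avg G n f"
proof -
  let ?A = "level_quotient G (n + m)" and ?B = "level_quotient G n"
  have "(\<Sum>p\<in>?A. 1 * f (trunc n p)) * card ?B = (\<Sum>p\<in>?A. 1) * (\<Sum>t\<in>?B. f t)"
  proof (rule sum_product_of_equivariant)
    fix t assume "t \<in> ?B"
    then obtain g where g: "g \<in> G" "t = trunc n g" by (auto simp: level_quotient_def)
    then have s: "trunc (n + m) g \<in> ?A" by (simp add: level_quotient_def)
    show "\<exists>\<sigma>. bij_betw \<sigma> ?A ?A \<and> (\<forall>p\<in>?A. 1 = (1::real) \<and> trunc n (\<sigma> p) = trunc n p \<circ> t)"
      by (rule exI[of _ "\<lambda>p. p \<circ> trunc (n + m) g"])
        (use g in \<open>auto simp: level_quotient_bij_comp_right[OF s] trunc_comp G_Aut\<close>)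
  qed (rule level_quotient_bij_comp_left[OF trunc_level_quotient])
  moreover have "f (trunc n p) = f p" for p
    using f unfolding level_fun_def by (simp add: trunc_short)
  ultimately show ?thesis
    by (simp add: avg_def field_simps)
qed

end

locale fractal_group = tree_group G for G :: "('x::finite list \<Rightarrow> 'x list) set" +
  assumes two_letters: "CARD('x) \<ge> 2"
    and ssf: "super_strongly_fractal G"
begin

lemma section_G: "g \<in> G \<Longrightarrow> section_at g v \<in> G"
  using ssf by (auto simp: super_strongly_fractal_def self_similar_def sect_eq_section[symmetric] G_Aut)

lemma section_level_quotient: "p \<in> level_quotient G (n + m) \<Longrightarrow> length v = n \<Longrightarrow> section_at p v \<in> level_quotient G m"
  unfolding level_quotient_def by (auto simp: section_trunc G_Aut intro!: imageI section_G)

lemma stabilizer_sections: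
  assumes "t \<in> G" and "length v = n" and "n \<ge> 1"
  obtains s where "s \<in> G" "\<And>w. length w = n \<Longrightarrow> s w = w" "section_at s v = t"
proof -
  have "t \<in> (\<lambda>g. sect g v) ` (level_stab n \<inter> G)"
    using ssf assms by (auto simp: super_strongly_fractal_def level_def)
  then obtain s where "s \<in> level_stab n \<inter> G" "sect s v = t" by blast
  then show thesis
    using that[of s] by (auto simp: level_stab_def level_def sect_eq_section)
qed

text \<open>The section at a vertex \<open>v\<close> of level \<open>n\<close> is uniform and independent of the action on level \<open>n\<close>,
  since super strong fractality provides elements of the level stabilizer with prescribed section
  at \<open>v\<close>.\<close>

lemma avg_mult_section:
  assumes f: "level_fun n f" and v: "length v = n" and n: "n \<ge> 1"
  shows "avg G (n + m) (\<lambda>p. f p * F (section_at p v)) = avg G (n + m) f * avg G m F"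
proof -
  let ?A = "level_quotient G (n + m)" and ?B = "level_quotient G m"
  have "(\<Sum>p\<in>?A. f p * F (section_at p v)) * card ?B = (\<Sum>p\<in>?A. f p) * (\<Sum>t\<in>?B. F t)"
  proof (rule sum_product_of_equivariant[where \<phi> = "\<lambda>p. section_at p v"])
    fix t assume "t \<in> ?B"
    then obtain t' where t': "t' \<in> G" "t = trunc m t'" by (auto simp: level_quotient_def)
    obtain s where s: "s \<in> G" "\<And>w. length w = n \<Longrightarrow> s w = w" "section_at s v = t'"
      using stabilizer_sections[OF t'(1) v n] by metis
    have sA: "trunc (n + m) s \<in> ?A" using s by (simp add: level_quotient_def)
    have "f (p \<circ> trunc (n + m) s) = f p" for p
      using f s unfolding level_fun_def by (simp add: trunc_short)
    moreover have "section_at (p \<circ> trunc (n + m) s) v = section_at p v \<circ> t" for p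
      using s v t' by (simp add: section_comp G_Aut section_trunc trunc_short)
    ultimately show "\<exists>\<sigma>. bij_betw \<sigma> ?A ?A \<and>
        (\<forall>p\<in>?A. f (\<sigma> p) = f p \<and> section_at (\<sigma> p) v = section_at p v \<circ> t)"
      using level_quotient_bij_comp_right[OF sA] by blast
  qed (rule level_quotient_bij_comp_left, rule section_level_quotient[OF _ v])
  then show ?thesis by (simp add: avg_def field_simps)
qed

lemma transitive:
  assumes "n \<ge> 1"
  shows "\<forall>u \<in> {w. length w = n}. \<forall>v \<in> {w. length w = n}. \<exists>g\<in>G. g u = v"
  using ssf assms unfolding super_strongly_fractal_def level_transitive_def level_def by simp

text \<open>Burnside's orbit count for a transitive action.\<close>

lemma avg_num_fixed:
  assumes "m \<ge> 1"
  shows "avg G m (\<lambda>p. num_fixed m p) = 1"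
proof -
  let ?A = "level_quotient G m" and ?W = "{w :: 'x list. length w = m}"
  have eq: "card {p \<in> ?A. p u = u} = card {p \<in> ?A. p u = u'}" if uu': "u \<in> ?W" "u' \<in> ?W" for u u'
  proof -
    obtain g where g: "g \<in> G" "g u = u'"
      using transitive[OF assms] uu' by blast
    define t where "t = trunc m g"
    have t: "t \<in> ?A" "t u = u'" using g uu' by (auto simp: t_def level_quotient_def trunc_short)
    show ?thesis
    proof (rule bij_betw_same_card[where f = "\<lambda>p. t \<circ> p"])
      show "bij_betw (\<lambda>p. t \<circ> p) {p \<in> ?A. p u = u} {p \<in> ?A. p u = u'}"
        using level_quotient_Aut[OF t(1)] t
        by (intro bij_betwI[where g = "\<lambda>p. finv t \<circ> p"])
          (auto simp: level_quotient_comp level_quotient_inv comp_assoc[symmetric])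
    qed
  qed
  have card_fix: "real (card ?W) * card {p \<in> ?A. p u = u} = card ?A" if u: "u \<in> ?W" for u
  proof -
    have "card ?A = (\<Sum>u'\<in>?W. card {p \<in> ?A. p u = u'})"
      using u by (subst card_eq_sum, subst sum.group[symmetric, where T = ?W and g = "\<lambda>p. p u"])
        (auto simp: level_quotient_Aut)
    also have "\<dots> = (\<Sum>u'\<in>?W. card {p \<in> ?A. p u = u})"
      using eq[OF u] by (intro sum.cong) auto
    finally show ?thesis by simp
  qed
  have W: "card ?W > 0" by (simp add: card_words)
  have "(\<Sum>p\<in>?A. real (num_fixed m p)) = (\<Sum>p\<in>?A. \<Sum>u\<in>?W. if p u = u then 1 else 0)"
    unfolding num_fixed_def by (intro sum.cong refl) (simp add: sum.If_cases Int_def)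
  also have "\<dots> = (\<Sum>u\<in>?W. \<Sum>p\<in>?A. if p u = u then 1 else 0)" by (rule sum.swap)
  also have "\<dots> = (\<Sum>u\<in>?W. real (card {p \<in> ?A. p u = u}))"
    by (intro sum.cong refl) (simp add: sum.If_cases Int_def)
  also have "\<dots> = (\<Sum>u\<in>?W. card ?A / card ?W)"
  proof (rule sum.cong[OF refl])
    fix u assume "u \<in> ?W"
    from card_fix[OF this] show "real (card {p \<in> ?A. p u = u}) = card ?A / card ?W"
      by (subst nonzero_eq_divide_eq) (use W in linarith, simp only: mult.commute)
  qed
  also have "\<dots> = card ?A" by (simp add: Ex_list_of_length)
  finally show ?thesis by (simp add: avg_def)
qed

lemma num_fixed_add:
  fixes p :: "'x list \<Rightarrow> 'x list"
  assumes p: "p \<in> Aut"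
  shows "num_fixed (n + m) p = (\<Sum>v | length v = n \<and> p v = v. num_fixed m (section_at p v))"
proof -
  let ?S = "SIGMA v:{v :: 'x list. length v = n \<and> p v = v}. {w. length w = m \<and> section_at p v w = w}"
  have "bij_betw (\<lambda>(v, w). v @ w) ?S {w. length w = n + m \<and> p w = w}"
  proof (rule bij_betwI[where g = "\<lambda>w. (take n w, drop n w)"])
    have "p (v @ w) = v @ w" if "p v = v" "section_at p v w = w" for v w
      using Aut_append[OF p, of v w] that by simp
    then show "(\<lambda>(v, w). v @ w) \<in> ?S \<rightarrow> {w. length w = n + m \<and> p w = w}" by auto
    show "(\<lambda>w. (take n w, drop n w)) \<in> {w. length w = n + m \<and> p w = w} \<rightarrow> ?S"
    proof (clarsimp, intro conjI)
      fix w assume w: "length w = n + m" "p w = w"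
      then have "p (take n w) @ section_at p (take n w) (drop n w) = take n w @ drop n w"
        using Aut_append[OF p, of "take n w" "drop n w"] by simp
      moreover have "length (p (take n w)) = length (take n w)" using p by (rule Aut_length)
      ultimately have "p (take n w) = take n w \<and> section_at p (take n w) (drop n w) = drop n w"
        by (metis append_eq_append_conv)
      then show "p (take n w) = take n w" "section_at p (take n w) (drop n w) = drop n w" by simp_all
    qed
  qed auto
  from bij_betw_same_card[OF this] have "num_fixed (n + m) p = card ?S"
    unfolding num_fixed_def by simp
  also have "\<dots> = (\<Sum>v | length v = n \<and> p v = v. num_fixed m (section_at p v))"
    unfolding num_fixed_def by (rule card_SigmaI) auto
  finally show ?thesis .
qed

text \<open>Every fixed vertex of level \<open>n\<close> contributes the mean of \<open>F\<close>, independently of the weight \<open>f\<close>.\<close>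

lemma avg_mult_sum_fixed:
  assumes f: "level_fun n f" and n: "n \<ge> 1"
  shows "avg G (n + m) (\<lambda>p. f p * (\<Sum>v | length v = n \<and> p v = v. F (section_at p v)))
    = avg G n (\<lambda>p. f p * num_fixed n p) * avg G m F"
proof -
  let ?W = "{v :: 'x list. length v = n}"
  let ?f = "\<lambda>v p. f p * (if p v = v then 1 else 0)"
  have lf: "level_fun n (?f v)" if "v \<in> ?W" for v
    using f that unfolding level_fun_def by (intro allI impI) (metis (mono_tags, lifting) mem_Collect_eq)
  have filter: "(\<Sum>v | length v = n \<and> p v = v. h v) = (\<Sum>v\<in>?W. (if p v = v then 1 else 0) * h v)"
    for h :: "'x list \<Rightarrow> real" and p
    by (rule sum.mono_neutral_cong_left) auto
  have "avg G (n + m) (\<lambda>p. f p * (\<Sum>v | length v = n \<and> p v = v. F (section_at p v)))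
    = avg G (n + m) (\<lambda>p. \<Sum>v\<in>?W. ?f v p * F (section_at p v))"
    by (simp only: filter sum_distrib_left mult.assoc)
  also have "\<dots> = (\<Sum>v\<in>?W. avg G n (?f v) * avg G m F)"
    unfolding avg_sum
  proof (rule sum.cong[OF refl])
    fix v assume v: "v \<in> ?W"
    show "avg G (n + m) (\<lambda>p. ?f v p * F (section_at p v)) = avg G n (?f v) * avg G m F"
      using avg_mult_section[OF lf[OF v], of v m F] avg_level_fun[OF lf[OF v], of m] v n by simp
  qed
  also have "\<dots> = avg G n (\<lambda>p. \<Sum>v\<in>?W. ?f v p) * avg G m F"
    by (simp add: avg_sum sum_distrib_right)
  also have "(\<lambda>p. \<Sum>v\<in>?W. ?f v p) = (\<lambda>p. f p * num_fixed n p)"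
    by (intro ext) (simp add: num_fixed_def sum_distrib_left[symmetric] sum.If_cases Int_def)
  finally show ?thesis .
qed

text \<open>Below each fixed vertex of level \<open>n\<close> there is on average one fixed vertex of level \<open>n + m\<close>.\<close>

lemma num_fixed_martingale:
  assumes f: "level_fun n f" and n: "n \<ge> 1" and m: "m \<ge> 1"
  shows "avg G (n + m) (\<lambda>p. f p * num_fixed (n + m) p) = avg G (n + m) (\<lambda>p. f p * num_fixed n p)"
proof -
  have lf: "level_fun n (\<lambda>p. f p * num_fixed n p)"
    unfolding level_fun_def
  proof (intro allI impI)
    fix p q :: "'x list \<Rightarrow> 'x list" assume h: "\<forall>w. length w = n \<longrightarrow> p w = q w"
    then have "{w. length w = n \<and> p w = w} = {w. length w = n \<and> q w = w}" by auto
    moreover have "f p = f q" using f h unfolding level_fun_def by blast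
    ultimately show "f p * num_fixed n p = f q * num_fixed n q" by (simp add: num_fixed_def)
  qed
  have "avg G (n + m) (\<lambda>p. f p * num_fixed (n + m) p)
      = avg G (n + m) (\<lambda>p. f p * (\<Sum>v | length v = n \<and> p v = v. real (num_fixed m (section_at p v))))"
    by (rule avg_cong) (simp add: num_fixed_add[OF level_quotient_Aut])
  also have "\<dots> = avg G n (\<lambda>p. f p * num_fixed n p)"
    using avg_mult_sum_fixed[OF f n, of m "\<lambda>q. num_fixed m q"] avg_num_fixed[OF m] by simp
  finally show ?thesis using avg_level_fun[OF lf, of m] by simp
qed

end

section \<open>Almost no element fixes a deep vertex\<close>

lemma level_fun_num_fixed: "level_fun n (\<lambda>p. h (num_fixed n p))"
  unfolding level_fun_def
proof (intro allI impI)
  fix p q :: "'a list \<Rightarrow> 'a list" assume "\<forall>w. length w = n \<longrightarrow> p w = q w"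
  then have "{w. length w = n \<and> p w = w} = {w. length w = n \<and> q w = w}" by auto
  then show "h (num_fixed n p) = h (num_fixed n q)" by (simp add: num_fixed_def)
qed

context fractal_group
begin

definition fix_prob :: "nat \<Rightarrow> real" where
  "fix_prob n = avg G n (\<lambda>p. if 0 < num_fixed n p then 1 else 0)"

definition sqrt_mean :: "nat \<Rightarrow> real" where
  "sqrt_mean n = avg G n (\<lambda>p. sqrt (num_fixed n p))"

text \<open>The defect of concavity of the square root: for \<open>x > 0\<close>,
  \<open>\<surd>y = \<surd>x + (y - x) / (2 \<surd>x) - (\<surd>y - \<surd>x)\<^sup>2 / (2 \<surd>x)\<close>, and this is the last summand at
  \<open>x = X\<^sub>n\<close>, \<open>y = X\<^sub>N\<close>. When \<open>X\<^sub>n = 0\<close>, also \<open>X\<^sub>N = 0\<close> for \<open>N \<ge> n\<close> and nothing is lost.\<close>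

definition sqrt_loss :: "nat \<Rightarrow> nat \<Rightarrow> ('x list \<Rightarrow> 'x list) \<Rightarrow> real" where
  "sqrt_loss n N p = (if num_fixed n p = 0 then 0
     else (sqrt (num_fixed N p) - sqrt (num_fixed n p))\<^sup>2 / (2 * sqrt (num_fixed n p)))"

text \<open>In the expansion of \<open>\<surd>X\<close> the linear term has mean 0 by the martingale property, which leaves the
  quadratic one.\<close>

lemma sqrt_mean_diff:
  assumes n: "n \<ge> 1" and m: "m \<ge> 1"
  shows "sqrt_mean n - sqrt_mean (n + m) = avg G (n + m) (sqrt_loss n (n + m))"
proof -
  let ?N = "n + m"
  \<comment> \<open>The derivative of the square root, set to 0 at 0, where the martingale is absorbed.\<close>
  define w where "w = (\<lambda>x::nat. if x = 0 then 0 else 1 / (2 * sqrt x))"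
  have pointwise: "sqrt_loss n ?N p = (sqrt (num_fixed n p) - sqrt (num_fixed ?N p))
      + (w (num_fixed n p) * num_fixed ?N p - w (num_fixed n p) * num_fixed n p)" if p: "p \<in> level_quotient G ?N" for p
  proof (cases "num_fixed n p = 0")
    case True
    then have "\<forall>v. length v = n \<longrightarrow> p v \<noteq> v" by (auto simp: num_fixed_def)
    then have "num_fixed ?N p = 0" by (auto simp: num_fixed_add[OF level_quotient_Aut[OF p]])
    with True show ?thesis by (simp add: sqrt_loss_def w_def)
  next
    case False
    define x y where "x = sqrt (num_fixed n p)" and "y = sqrt (num_fixed ?N p)"
    have sq: "real (num_fixed n p) = x\<^sup>2" "real (num_fixed ?N p) = y\<^sup>2" by (simp_all add: x_def y_def)
    have xy: "x > 0" "y \<ge> 0" using False by (simp_all add: x_def y_def)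
    then have "(y - x)\<^sup>2 / (2 * x) = (x - y) + (1 / (2 * x) * y\<^sup>2 - 1 / (2 * x) * x\<^sup>2)"
      by (simp add: field_simps power2_eq_square)
    then show ?thesis
      using False xy by (simp add: sqrt_loss_def w_def x_def[symmetric] y_def[symmetric] sq)
  qed
  have "avg G ?N (sqrt_loss n ?N)
      = (avg G ?N (\<lambda>p. sqrt (num_fixed n p)) - avg G ?N (\<lambda>p. sqrt (num_fixed ?N p)))
        + (avg G ?N (\<lambda>p. w (num_fixed n p) * num_fixed ?N p) - avg G ?N (\<lambda>p. w (num_fixed n p) * num_fixed n p))"
    unfolding avg_diff[symmetric] avg_add[symmetric] by (rule avg_cong) (rule pointwise)
  also have "avg G ?N (\<lambda>p. sqrt (num_fixed n p)) = sqrt_mean n"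
    unfolding sqrt_mean_def by (rule avg_level_fun) (rule level_fun_num_fixed)
  also have "avg G ?N (\<lambda>p. w (num_fixed n p) * num_fixed ?N p) = avg G ?N (\<lambda>p. w (num_fixed n p) * num_fixed n p)"
    by (rule num_fixed_martingale[OF level_fun_num_fixed n m])
  finally show ?thesis by (simp add: sqrt_mean_def)
qed

lemma sqrt_loss_nonneg: "0 \<le> sqrt_loss n N p"
  by (simp add: sqrt_loss_def)

lemma convergent_sqrt_mean: "convergent sqrt_mean"
proof -
  have dec: "decseq (\<lambda>n. sqrt_mean (Suc n))"
  proof (rule decseq_SucI)
    fix n
    have "0 \<le> avg G (Suc n + 1) (sqrt_loss (Suc n) (Suc n + 1))"
      by (rule avg_nonneg) (rule sqrt_loss_nonneg)
    then show "sqrt_mean (Suc (Suc n)) \<le> sqrt_mean (Suc n)"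
      using sqrt_mean_diff[of "Suc n" 1] by simp
  qed
  have "\<forall>n. 0 \<le> sqrt_mean (Suc n)"
    unfolding sqrt_mean_def by (intro allI avg_nonneg) simp
  from decseq_convergent[OF dec this] obtain L where "(\<lambda>n. sqrt_mean (Suc n)) \<longlonglongrightarrow> L" by blast
  then show ?thesis unfolding convergent_def using filterlim_sequentially_Suc by blast
qed

definition few_fixed :: "nat \<Rightarrow> nat \<Rightarrow> ('x list \<Rightarrow> 'x list) \<Rightarrow> real" where
  "few_fixed c n p = (if 0 < num_fixed n p \<and> num_fixed n p \<le> c then 1 else 0)"

definition trivial_at :: "nat \<Rightarrow> ('x list \<Rightarrow> 'x list) \<Rightarrow> real" where
  "trivial_at m q = (if \<forall>w. length w = m \<longrightarrow> q w = w then 1 else 0)"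

lemma avg_trivial_at_pos: "0 < avg G m (trivial_at m)"
proof -
  have "1 = trivial_at m id" by (simp add: trivial_at_def)
  also have "\<dots> \<le> (\<Sum>p\<in>level_quotient G m. trivial_at m p)"
    by (rule member_le_sum[OF level_quotient_id]) (auto simp: trivial_at_def)
  finally have "0 < (\<Sum>p\<in>level_quotient G m. trivial_at m p)" by simp
  then show ?thesis unfolding avg_def by (intro divide_pos_pos) (auto simp: card_gt_0_iff)
qed

text \<open>If one of at most \<open>c\<close> fixed vertices has a section that is trivial on \<open>m\<close> levels, then there are
  at least \<open>4 c\<close> fixed vertices \<open>m\<close> levels further down. The square root of their number then at
  least doubles, and the loss is at least 1/2.\<close>

lemma few_fixed_le_sqrt_loss:
  assumes p: "p \<in> Aut" and c: "c \<ge> 1" and m: "4 * c \<le> CARD('x) ^ m"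
  shows "few_fixed c n p * (\<Sum>v | length v = n \<and> p v = v. trivial_at m (section_at p v))
    \<le> 2 * real c * sqrt_loss n (n + m) p"
proof (cases "few_fixed c n p = 1 \<and> (\<exists>v. length v = n \<and> p v = v \<and> trivial_at m (section_at p v) \<noteq> 0)")
  case False
  then consider "few_fixed c n p = 0" | "\<forall>v. length v = n \<and> p v = v \<longrightarrow> trivial_at m (section_at p v) = 0"
    by (auto simp: few_fixed_def split: if_splits)
  then have "few_fixed c n p * (\<Sum>v | length v = n \<and> p v = v. trivial_at m (section_at p v)) = 0"
    by cases simp_all
  also have "\<dots> \<le> 2 * real c * sqrt_loss n (n + m) p" by (simp add: sqrt_loss_nonneg)
  finally show ?thesis .
next
  case True
  then obtain v where v: "length v = n" "p v = v" and triv: "trivial_at m (section_at p v) \<noteq> 0" by blast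
  from triv have "{w. length w = m \<and> section_at p v w = w} = {w. length w = m}"
    by (auto simp: trivial_at_def split: if_splits)
  then have "4 * c \<le> num_fixed m (section_at p v)" using m by (simp add: num_fixed_def card_words)
  also have "\<dots> \<le> num_fixed (n + m) p"
    unfolding num_fixed_add[OF p] by (rule member_le_sum) (use v in auto)
  finally have many: "4 * c \<le> num_fixed (n + m) p" .
  from True have few: "1 \<le> num_fixed n p" "num_fixed n p \<le> c"
    by (auto simp: few_fixed_def split: if_splits)
  define x where "x = sqrt (num_fixed n p)"
  have x: "1 \<le> x" using few by (simp add: x_def)
  have "2 * x = sqrt (4 * num_fixed n p)" by (simp add: x_def real_sqrt_mult)
  also have "\<dots> \<le> sqrt (num_fixed (n + m) p)" using few many by simp
  finally have "x\<^sup>2 \<le> (sqrt (num_fixed (n + m) p) - x)\<^sup>2"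
    using x by (intro power_mono) auto
  then have "x\<^sup>2 / (2 * x) \<le> sqrt_loss n (n + m) p"
    using few x unfolding sqrt_loss_def x_def[symmetric] by (simp add: divide_right_mono)
  moreover have "1 / 2 \<le> x\<^sup>2 / (2 * x)" using x by (simp add: power2_eq_square)
  ultimately have loss: "1 / 2 \<le> sqrt_loss n (n + m) p" by linarith
  have "(\<Sum>v | length v = n \<and> p v = v. trivial_at m (section_at p v)) \<le> (\<Sum>v | length v = n \<and> p v = v. 1)"
    by (rule sum_mono) (simp add: trivial_at_def)
  also have "\<dots> \<le> c" using few by (simp add: num_fixed_def)
  also have "\<dots> \<le> 2 * real c * sqrt_loss n (n + m) p"
    using mult_left_mono[OF loss, of "2 * real c"] by simp
  finally show ?thesis using True by simp
qed

text \<open>The mean of \<open>\<surd>X\<^sub>n\<close> is decreasing and bounded below, so its decrements tend to 0, and they dominate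
  a fixed multiple of the probability that \<open>0 < X\<^sub>n \<le> c\<close>.\<close>

lemma few_fixed_tendsto_0:
  assumes c: "c \<ge> 1"
  shows "(\<lambda>n. avg G n (few_fixed c n)) \<longlonglongrightarrow> 0"
proof -
  \<comment> \<open>A section that is trivial on \<open>m\<close> levels has at least \<open>4 c\<close> fixed vertices.\<close>
  obtain m where m: "4 * c < 2 ^ m" using less_exp by blast
  have m1: "m \<ge> 1" using m c by (cases m) auto
  have "(2::nat) ^ m \<le> CARD('x) ^ m" using two_letters by (intro power_mono) auto
  with m have big: "4 * c \<le> CARD('x) ^ m" by linarith
  define \<delta> where "\<delta> = avg G m (trivial_at m)"
  have \<delta>: "0 < \<delta>" unfolding \<delta>_def by (rule avg_trivial_at_pos)
  have bound: "avg G n (few_fixed c n) \<le> 2 * real c / \<delta> * (sqrt_mean n - sqrt_mean (n + m))"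
    if n: "n \<ge> 1" for n
  proof -
    have lf: "level_fun n (few_fixed c n)"
      unfolding few_fixed_def by (rule level_fun_num_fixed)
    have "avg G n (few_fixed c n) \<le> avg G n (\<lambda>p. few_fixed c n p * num_fixed n p)"
      by (rule avg_mono) (auto simp: few_fixed_def)
    then have "avg G n (few_fixed c n) * \<delta> \<le> avg G n (\<lambda>p. few_fixed c n p * num_fixed n p) * \<delta>"
      using \<delta> by (simp add: mult_right_mono)
    also have "\<dots> = avg G (n + m)
        (\<lambda>p. few_fixed c n p * (\<Sum>v | length v = n \<and> p v = v. trivial_at m (section_at p v)))"
      unfolding \<delta>_def by (rule avg_mult_sum_fixed[OF lf n, symmetric])
    also have "\<dots> \<le> avg G (n + m) (\<lambda>p. 2 * real c * sqrt_loss n (n + m) p)"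
      by (rule avg_mono) (rule few_fixed_le_sqrt_loss[OF level_quotient_Aut c big])
    also have "\<dots> = 2 * real c * (sqrt_mean n - sqrt_mean (n + m))"
      by (simp add: avg_cmult sqrt_mean_diff[OF n m1])
    finally show ?thesis using \<delta> by (simp add: field_simps)
  qed
  obtain L where L: "sqrt_mean \<longlonglongrightarrow> L" using convergent_sqrt_mean unfolding convergent_def by blast
  have "(\<lambda>n. 2 * real c / \<delta> * (sqrt_mean n - sqrt_mean (n + m))) \<longlonglongrightarrow> 2 * real c / \<delta> * (L - L)"
    by (intro tendsto_intros L LIMSEQ_ignore_initial_segment)
  then have "(\<lambda>n. 2 * real c / \<delta> * (sqrt_mean n - sqrt_mean (n + m))) \<longlonglongrightarrow> 0" by simp
  then show ?thesis
  proof (rule tendsto_sandwich[OF _ _ tendsto_const, rotated 2])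
    show "\<forall>\<^sub>F n in sequentially. 0 \<le> avg G n (few_fixed c n)"
      by (intro always_eventually allI avg_nonneg) (simp add: few_fixed_def)
    show "\<forall>\<^sub>F n in sequentially. avg G n (few_fixed c n) \<le> 2 * real c / \<delta> * (sqrt_mean n - sqrt_mean (n + m))"
      using bound by (intro eventually_sequentiallyI[of 1]) auto
  qed
qed

text \<open>Markov's inequality deals with the elements that have more than \<open>c\<close> fixed vertices.\<close>

lemma fix_prob_tendsto_0: "fix_prob \<longlonglongrightarrow> 0"
proof (rule LIMSEQ_I)
  fix \<epsilon> :: real assume \<epsilon>: "0 < \<epsilon>"
  obtain c where c: "2 / \<epsilon> < real c" using reals_Archimedean2 by blast
  have c1: "c \<ge> 1" using c \<epsilon> by (cases c) (auto simp: field_simps)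
  have c2: "1 / real c < \<epsilon> / 2" using c \<epsilon> c1 by (simp add: field_simps)
  obtain n0 where n0: "\<And>n. n \<ge> n0 \<Longrightarrow> \<bar>avg G n (few_fixed c n)\<bar> < \<epsilon> / 2"
    using LIMSEQ_D[OF few_fixed_tendsto_0[OF c1], of "\<epsilon> / 2"] \<epsilon> by auto
  have "norm (fix_prob n - 0) < \<epsilon>" if n: "n \<ge> max n0 1" for n
  proof -
    have nonneg: "0 \<le> fix_prob n" unfolding fix_prob_def by (rule avg_nonneg) simp
    have "fix_prob n \<le> avg G n (\<lambda>p. few_fixed c n p + 1 / c * num_fixed n p)"
      unfolding fix_prob_def by (rule avg_mono) (use c1 in \<open>auto simp: few_fixed_def field_simps\<close>)
    also have "\<dots> = avg G n (few_fixed c n) + 1 / c"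
      using avg_num_fixed[of n] n unfolding avg_add avg_cmult by simp
    also have "\<dots> < \<epsilon>" using n0[of n] n c2 by auto
    finally show ?thesis using nonneg by simp
  qed
  then show "\<exists>no. \<forall>n\<ge>no. norm (fix_prob n - 0) < \<epsilon>" by blast
qed

end

section \<open>Rigid stabilizers have large sections\<close>

text \<open>The condition on automorphisms that defines \<^const>\<open>rist\<close>, stated without reference to a group so
  that it also applies to truncations.\<close>

definition rigid_at :: "'x list \<Rightarrow> ('x list \<Rightarrow> 'x list) \<Rightarrow> bool" where
  "rigid_at v r \<longleftrightarrow> r \<in> Aut \<and> (\<forall>w. w \<notin> subtree v \<longrightarrow> r w = w)"

lemma append_in_subtree: "length x = length v \<Longrightarrow> x @ u \<in> subtree v \<longleftrightarrow> x = v"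
  by (auto simp: subtree_def)

lemma rigid_at_off: "rigid_at v r \<Longrightarrow> length x = length v \<Longrightarrow> x \<noteq> v \<Longrightarrow> r (x @ u) = x @ u"
  by (simp add: rigid_at_def append_in_subtree)

lemma rigid_at_level:
  assumes r: "rigid_at v r" and x: "length x = length v"
  shows "r x = x"
proof (cases "x = v")
  case True
  have rA: "r \<in> Aut" using r by (simp add: rigid_at_def)
  show ?thesis
  proof (rule ccontr)
    assume ne: "r x \<noteq> x"
    have "r (r x @ []) = r x @ []"
      using rA x ne True by (intro rigid_at_off[OF r]) auto
    then have "r (r x) = r x" by simp
    then show False using ne Aut_inj[OF rA] by blast
  qed
qed (use rigid_at_off[OF r x, of "[]"] in simp)

lemma rigid_at_finv: "rigid_at v r \<Longrightarrow> rigid_at v (finv r)"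
  unfolding rigid_at_def by (metis Aut_inv_apply(1) inv_in_Aut)

lemma rigid_at_comp: "rigid_at v r \<Longrightarrow> rigid_at v s \<Longrightarrow> rigid_at v (s \<circ> r)"
  by (simp add: rigid_at_def)

lemma rigid_at_trunc:
  assumes "rigid_at v r"
  shows "rigid_at v (trunc n r)"
proof -
  have "take n w \<notin> subtree v" if "w \<notin> subtree v" for w
  proof
    assume "take n w \<in> subtree v"
    then obtain u where "take n w = v @ u" by (auto simp: subtree_def)
    then have "w = v @ (u @ drop n w)" by (metis append_assoc append_take_drop_id)
    then show False using that unfolding subtree_def by blast
  qed
  then show ?thesis using assms by (simp add: rigid_at_def trunc_def)
qed

context tree_group
begin

lemma rist_iff: "r \<in> rist G v \<longleftrightarrow> r \<in> G \<and> rigid_at v r"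
  by (auto simp: rist_def rigid_at_def G_Aut)

text \<open>The factors \<open>rist G v'\<close> with \<open>v' \<noteq> v\<close> act trivially below \<open>v\<close>, so passing from \<open>rist G v\<close> to
  \<open>Rist G n\<close> produces no new sections at \<open>v\<close>.\<close>

lemma Rist_section:
  assumes "\<rho> \<in> Rist G n" and v: "length v = n"
  shows "\<rho> \<in> G \<and> \<rho> v = v \<and> (\<exists>r\<in>rist G v. section_at \<rho> v = section_at r v)"
  using assms(1) unfolding Rist_def
proof (induction \<rho> rule: generate.induct)
  case one
  have "id \<in> rist G v" by (simp add: rist_def)
  then have "id \<in> G \<and> id v = v \<and> (\<exists>r\<in>rist G v. section_at id v = section_at r v)"
    by (metis G_id id_apply)
  then show ?case by (simp only: one_tree_Aut)
next
  case (incl h)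
  then obtain v' where v': "length v' = n" and h: "h \<in> G" "rigid_at v' h"
    by (auto simp: level_def rist_iff)
  have "\<exists>r\<in>rist G v. section_at h v = section_at r v"
  proof (cases "v' = v")
    case True
    then show ?thesis using h by (auto simp: rist_iff)
  next
    case False
    then have "section_at h v = section_at id v"
      using rigid_at_off[OF h(2)] v v' by (auto simp: section_at_def)
    moreover have "id \<in> rist G v" by (simp add: rist_def)
    ultimately show ?thesis by blast
  qed
  then show ?case using h rigid_at_level[OF h(2)] v v' by simp
next
  case (inv h)
  then obtain v' where v': "length v' = n" and h0: "h \<in> G" "rigid_at v' h"
    by (auto simp: level_def rist_iff)
  then have h: "finv h \<in> G" "rigid_at v' (finv h)" by (simp_all add: G_inv rigid_at_finv)
  have "\<exists>r\<in>rist G v. section_at (finv h) v = section_at r v"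
  proof (cases "v' = v")
    case True
    then show ?thesis using h by (auto simp: rist_iff)
  next
    case False
    then have "section_at (finv h) v = section_at id v"
      using rigid_at_off[OF h(2)] v v' by (auto simp: section_at_def)
    moreover have "id \<in> rist G v" by (simp add: rist_def)
    ultimately show ?thesis by blast
  qed
  then show ?case using h h0 rigid_at_level[OF h(2)] v v' by (simp add: m_inv_tree_Aut G_Aut)
next
  case (eng h1 h2)
  then obtain r1 r2 where r: "r1 \<in> rist G v" "section_at h1 v = section_at r1 v" "r2 \<in> rist G v" "section_at h2 v = section_at r2 v"
    and h: "h1 \<in> G" "h1 v = v" "h2 \<in> G" "h2 v = v"
    by auto
  have "r2 \<circ> r1 \<in> rist G v" using r by (simp add: rist_iff G_comp rigid_at_comp)
  moreover have "section_at (h2 \<circ> h1) v = section_at (r2 \<circ> r1) v"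
    using r h rigid_at_level[of v r1 v] by (simp add: section_comp G_Aut rist_iff)
  ultimately have "h2 \<circ> h1 \<in> G \<and> (h2 \<circ> h1) v = v \<and> (\<exists>r\<in>rist G v. section_at (h2 \<circ> h1) v = section_at r v)"
    using h by (metis G_comp comp_apply)
  then show ?case by (simp only: mult_tree_Aut)
qed

definition rist_sections :: "'x list \<Rightarrow> nat \<Rightarrow> ('x list \<Rightarrow> 'x list) set" where
  "rist_sections v m = (\<lambda>r. trunc m (section_at r v)) ` rist G v"

end

context fractal_group
begin

lemma rist_sections_subset: "rist_sections v m \<subseteq> level_quotient G m"
  by (auto simp: rist_sections_def level_quotient_def rist_iff intro!: imageI section_G)

lemma finite_rist_sections [simp]: "finite (rist_sections v m)"
  by (rule finite_subset[OF rist_sections_subset]) simp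

text \<open>Each \<open>t \<in> G\<close> is the section at \<open>v\<close> of some \<open>s\<close> in the level stabilizer. Writing \<open>s\<close> as a product
  of an element of \<open>Rist G n\<close> and one of finitely many coset representatives shows that \<open>t\<close> lies in
  one of finitely many cosets of the sections of \<open>rist G v\<close>. The constant is thus the index of
  \<open>Rist G n\<close>, the same for all \<open>m\<close>.\<close>

lemma rist_sections_bounded_index:
  assumes br: "branch G" and v: "length v = n" and n: "n \<ge> 1"
  shows "\<exists>C. \<forall>m. card (level_quotient G m) \<le> C * card (rist_sections v m)"
proof -
  let ?K = "tree_Aut\<lparr>carrier := G\<rparr>"
  define \<C> where "\<C> = rcosets\<^bsub>?K\<^esub> (Rist G n)"
  have coset: "Rist G n #>\<^bsub>?K\<^esub> a = {a \<circ> \<rho> | \<rho>. \<rho> \<in> Rist G n}" for a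
    by (auto simp: r_coset_def)
  have finite: "finite \<C>" using br n by (simp add: branch_def \<C>_def)
  \<comment> \<open>Products apply the left factor first, so a right coset of \<open>Rist G n\<close> consists of the maps \<open>a \<circ> \<rho>\<close>.\<close>
  define rep where "rep c = (SOME a. a \<in> G \<and> c = {a \<circ> \<rho> | \<rho>. \<rho> \<in> Rist G n})" for c
  have rep: "rep c \<in> G \<and> c = {rep c \<circ> \<rho> | \<rho>. \<rho> \<in> Rist G n}" if "c \<in> \<C>" for c
  proof -
    have "\<exists>a\<in>G. c = {a \<circ> \<rho> | \<rho>. \<rho> \<in> Rist G n}"
      using that unfolding \<C>_def RCOSETS_def coset by simp
    then show ?thesis unfolding rep_def Bex_def by (rule someI_ex)
  qed
  have "card (level_quotient G m) \<le> card \<C> * card (rist_sections v m)" for m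
  proof -
    have "level_quotient G m \<subseteq> (\<lambda>(c, \<kappa>). trunc m (section_at (rep c) v) \<circ> \<kappa>) ` (\<C> \<times> rist_sections v m)"
    proof
      fix p assume "p \<in> level_quotient G m"
      then obtain t where t: "t \<in> G" "p = trunc m t" by (auto simp: level_quotient_def)
      obtain s where s: "s \<in> G" "\<And>w. length w = n \<Longrightarrow> s w = w" "section_at s v = t"
        using stabilizer_sections[OF t(1) v n] by metis
      define c where "c = {s \<circ> \<rho> | \<rho>. \<rho> \<in> Rist G n}"
      have "\<exists>a\<in>G. c = {a \<circ> \<rho> | \<rho>. \<rho> \<in> Rist G n}" unfolding c_def using s(1) by blast
      then have c: "c \<in> \<C>" unfolding \<C>_def RCOSETS_def coset by simp
      have "id \<in> Rist G n"
        unfolding Rist_def using generate.one[of tree_Aut] by simp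
      then have "s \<circ> id \<in> c" unfolding c_def by blast
      then have "s \<in> {rep c \<circ> \<rho> | \<rho>. \<rho> \<in> Rist G n}" using rep[OF c] by simp
      then obtain \<rho> where \<rho>: "\<rho> \<in> Rist G n" "s = rep c \<circ> \<rho>" by blast
      obtain r where r: "\<rho> \<in> G" "\<rho> v = v" "r \<in> rist G v" "section_at \<rho> v = section_at r v"
        using Rist_section[OF \<rho>(1) v] by blast
      have "t = section_at (rep c) v \<circ> section_at r v"
        using s(3) r unfolding \<rho>(2) by (simp add: section_comp G_Aut)
      then have "p = trunc m (section_at (rep c) v) \<circ> trunc m (section_at r v)"
        using t r by (simp add: trunc_comp G_Aut rist_iff)
      moreover have "trunc m (section_at r v) \<in> rist_sections v m"
        using r by (simp add: rist_sections_def)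
      ultimately show "p \<in> (\<lambda>(c, \<kappa>). trunc m (section_at (rep c) v) \<circ> \<kappa>) ` (\<C> \<times> rist_sections v m)"
        using c by (intro image_eqI[where x = "(c, trunc m (section_at r v))"]) auto
    qed
    from card_mono[OF _ this] have "card (level_quotient G m)
        \<le> card ((\<lambda>(c, \<kappa>). trunc m (section_at (rep c) v) \<circ> \<kappa>) ` (\<C> \<times> rist_sections v m))"
      using finite by simp
    also have "\<dots> \<le> card (\<C> \<times> rist_sections v m)"
      using finite by (intro card_image_le) simp
    finally show ?thesis by (simp add: card_cartesian_product)
  qed
  then show ?thesis by blast
qed

end

section \<open>Words and the edges they cross\<close>

text \<open>The letter \<open>(j, True)\<close> stands for the \<open>j\<close>-th generator and \<open>(j, False)\<close> for its inverse. The
  generators may act on any set; they are used both on vertices and on boundary points.\<close>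

fun step :: "(nat \<Rightarrow> 'a \<Rightarrow> 'a) \<Rightarrow> nat \<times> bool \<Rightarrow> 'a \<Rightarrow> 'a" where
  "step f (j, b) = (if b then f j else finv (f j))"

fun run :: "(nat \<Rightarrow> 'a \<Rightarrow> 'a) \<Rightarrow> (nat \<times> bool) list \<Rightarrow> 'a \<Rightarrow> 'a" where
  "run f [] = id"
| "run f (l # q) = run f q \<circ> step f l"

text \<open>The edge traversed when the letter is applied at \<open>x\<close>, named by its generator and its source. A
  letter and its inverse traverse the same edge in opposite directions.\<close>

fun edge :: "(nat \<Rightarrow> 'a \<Rightarrow> 'a) \<Rightarrow> nat \<times> bool \<Rightarrow> 'a \<Rightarrow> nat \<times> 'a" where
  "edge f (j, b) x = (j, if b then x else finv (f j) x)"

fun avoids :: "(nat \<Rightarrow> 'a \<Rightarrow> 'a) \<Rightarrow> nat \<times> 'a \<Rightarrow> (nat \<times> bool) list \<Rightarrow> 'a \<Rightarrow> bool" where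
  "avoids f e [] x = True"
| "avoids f e (l # q) x = (edge f l x \<noteq> e \<and> avoids f e q (step f l x))"

definition word_below :: "nat \<Rightarrow> (nat \<times> bool) list \<Rightarrow> bool" where
  "word_below k q \<longleftrightarrow> fst ` set q \<subseteq> {..<k}"

lemma word_below_simps [simp]:
  "word_below k []" "word_below k (l # q) \<longleftrightarrow> fst l < k \<and> word_below k q"
  by (auto simp: word_below_def)

lemma step_Aut:
  assumes "\<And>j. j < k \<Longrightarrow> f j \<in> Aut" and "fst l < k"
  shows "step f l \<in> Aut"
  using assms by (cases l) auto

lemma run_Aut:
  assumes "\<And>j. j < k \<Longrightarrow> f j \<in> Aut" and "word_below k q"
  shows "run f q \<in> Aut"
  using assms(2) by (induction q) (simp_all add: step_Aut[where k = k, OF assms(1)])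

text \<open>Away from \<open>v\<close> the element \<open>r\<close> is trivial, so only a step along the edge \<open>(i, v)\<close>, in either
  direction, notices it.\<close>

lemma step_perturb:
  fixes p :: "nat \<Rightarrow> 'x list \<Rightarrow> 'x list"
  assumes p: "\<And>j. j < k \<Longrightarrow> p j \<in> Aut" and r: "rigid_at v r" and l: "fst l < k"
    and x: "length x = length v" and not: "edge p l x \<noteq> (i, v)"
  shows "step (p(i := p i \<circ> r)) l (x @ u) = step p l (x @ u)"
proof (cases "fst l = i")
  case False
  then show ?thesis by (cases l) auto
next
  case True
  then obtain b where lb: "l = (i, b)" by (cases l) auto
  have A: "p i \<in> Aut" "r \<in> Aut" using p l r True by (auto simp: rigid_at_def)
  show ?thesis
  proof (cases b)
    case True
    then show ?thesis using not lb rigid_at_off[OF r x] by auto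
  next
    case False
    define y where "y = finv (p i) x"
    have y: "length y = length v" "y \<noteq> v" using A x not lb False by (auto simp: y_def)
    have "finv (p i) (x @ u) = y @ section_at (finv (p i)) x u"
      unfolding y_def using A by (intro Aut_append) simp
    then have "finv r (finv (p i) (x @ u)) = finv (p i) (x @ u)"
      using rigid_at_off[OF rigid_at_finv[OF r] y] by simp
    moreover have "finv (p i \<circ> r) = finv r \<circ> finv (p i)"
      using A by (intro o_inv_distrib Aut_bij)
    ultimately show ?thesis using lb False by simp
  qed
qed

text \<open>Elements of rigid stabilizers of \<open>v\<close> fix all vertices of the level of \<open>v\<close>, including \<open>v\<close> itself.\<close>

lemma edge_perturb:
  fixes p :: "nat \<Rightarrow> 'x list \<Rightarrow> 'x list"
  assumes p: "\<And>j. j < k \<Longrightarrow> p j \<in> Aut" and r: "rigid_at v r" and l: "fst l < k"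
    and x: "length x = length v"
  shows "edge (p(i := p i \<circ> r)) l x = edge p l x"
proof (cases "l = (i, False)")
  case False
  then show ?thesis by (cases l) auto
next
  case True
  have A: "p i \<in> Aut" "r \<in> Aut" using p l r True by (auto simp: rigid_at_def)
  have "finv (p i \<circ> r) = finv r \<circ> finv (p i)"
    using A by (intro o_inv_distrib Aut_bij)
  moreover have "finv r (finv (p i) x) = finv (p i) x"
    using A x by (intro rigid_at_level[OF rigid_at_finv[OF r]]) simp
  ultimately show ?thesis using True by simp
qed

text \<open>A walk on the level of \<open>v\<close> that avoids the edge \<open>(i, v)\<close> acts on the subtrees along it in a way
  that does not depend on the section of the \<open>i\<close>-th generator at \<open>v\<close>.\<close>

lemma avoids_perturb:
  fixes p :: "nat \<Rightarrow> 'x list \<Rightarrow> 'x list"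
  assumes p: "\<And>j. j < k \<Longrightarrow> p j \<in> Aut" and r: "rigid_at v r"
    and "word_below k q" and "length x = length v"
  shows "avoids (p(i := p i \<circ> r)) (i, v) q x \<longleftrightarrow> avoids p (i, v) q x"
    and "avoids p (i, v) q x \<Longrightarrow> run (p(i := p i \<circ> r)) q (x @ u) = run p q (x @ u)"
proof -
  define p' where "p' = p(i := p i \<circ> r)"
  have "(avoids p' (i, v) q x \<longleftrightarrow> avoids p (i, v) q x)
      \<and> (avoids p (i, v) q x \<longrightarrow> (\<forall>u. run p' q (x @ u) = run p q (x @ u)))"
    using assms(3,4)
  proof (induction q arbitrary: x)
    case (Cons l q)
    have l: "fst l < k" and x: "length x = length v" using Cons.prems by auto
    note cr = edge_perturb[where k = k and i = i and p = p, OF p r l x, folded p'_def]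
    show ?case
    proof (cases "edge p l x = (i, v)")
      case True
      then show ?thesis using cr by simp
    next
      case False
      note st = step_perturb[where k = k and p = p, OF p r l x False, folded p'_def]
      have sA: "step p l \<in> Aut" by (rule step_Aut[where k = k and f = p, OF p l])
      have "length (step p l x) = length v" using sA x by simp
      note IH = Cons.IH[OF _ this]
      have "step p' l x = step p l x" using st[of "[]"] by simp
      then show ?thesis using IH False cr Cons.prems by (simp add: st Aut_append[OF sA])
    qed
  qed simp
  then show "avoids (p(i := p i \<circ> r)) (i, v) q x \<longleftrightarrow> avoids p (i, v) q x"
    and "avoids p (i, v) q x \<Longrightarrow> run (p(i := p i \<circ> r)) q (x @ u) = run p q (x @ u)" by (auto simp: p'_def)
qed

section \<open>Counting closed walks\<close>

text \<open>The approximation on level \<open>length v + N\<close> of the following event: the edge \<open>(i, v)\<close>, followed by a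
  walk \<open>q\<close> that avoids it, returns to \<open>v\<close>, and some boundary point below \<open>v\<close> also returns to
  itself.\<close>

definition closes :: "(nat \<Rightarrow> 'x list \<Rightarrow> 'x list) \<Rightarrow> nat \<Rightarrow> (nat \<times> bool) list \<Rightarrow> 'x list \<Rightarrow> nat \<Rightarrow> bool" where
  "closes p i q v N \<longleftrightarrow> run p q (p i v) = v \<and> avoids p (i, v) q (p i v) \<and>
     (\<exists>u. length u = N \<and> run p q (p i (v @ u)) = v @ u)"

text \<open>The closed walk consists of one step along \<open>(i, v)\<close> and a walk that \<open>r\<close> does not affect. So its
  section at \<open>v\<close> after the perturbation is the original one preceded by the section of \<open>r\<close>, and
  a returning point below \<open>v\<close> is a fixed vertex of this product.\<close>

lemma closes_perturb:
  fixes p :: "nat \<Rightarrow> 'x::finite list \<Rightarrow> 'x list"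
  assumes p: "\<And>j. j < k \<Longrightarrow> p j \<in> Aut" and r: "rigid_at v r" and i: "i < k" and q: "word_below k q"
    and cl: "closes (p(i := p i \<circ> r)) i q v N"
  shows "run p q (p i v) = v"
    and "0 < num_fixed N (section_at (run p q \<circ> p i) v \<circ> section_at r v)"
proof -
  have A: "p i \<in> Aut" "r \<in> Aut" "run p q \<in> Aut"
    using p i r run_Aut[where k = k and f = p, OF p q] by (simp_all add: rigid_at_def)
  have rv: "r v = v" by (rule rigid_at_level[OF r refl])
  have len: "length (p i v) = length v" using A by simp
  define p' where "p' = p(i := p i \<circ> r)"
  have p'i: "p' i = p i \<circ> r" by (simp add: p'_def)
  from cl obtain u where u: "length u = N" "run p' q (p' i (v @ u)) = v @ u"
    and av': "avoids p' (i, v) q (p' i v)" and close: "run p' q (p' i v) = v"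
    unfolding closes_def p'_def[symmetric] by blast
  have av: "avoids p (i, v) q (p i v)"
    using av' avoids_perturb(1)[where k = k and p = p and i = i, OF p r q len, folded p'_def] rv
    by (simp add: p'i)
  have same: "run p' q (p i v @ w) = run p q (p i v @ w)" for w
    using avoids_perturb(2)[where k = k and p = p and i = i, OF p r q len av, folded p'_def] .
  show closed: "run p q (p i v) = v"
    using close same[of "[]"] rv by (simp add: p'i)
  define h where "h = run p q \<circ> p i"
  have hA: "h \<in> Aut" unfolding h_def using A by simp
  have "v @ u = h (r (v @ u))"
  proof -
    have "p' i (v @ u) = p i v @ section_at (p i) v (section_at r v u)"
      using Aut_append[OF A(2), of v u] Aut_append[OF A(1), of v "section_at r v u"] rv by (simp add: p'i)
    then have "v @ u = run p q (p i v @ section_at (p i) v (section_at r v u))" using u same by simp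
    also have "\<dots> = h (r (v @ u))"
      using Aut_append[OF A(2), of v u] Aut_append[OF A(1), of v "section_at r v u"] rv by (simp add: h_def)
    finally show ?thesis .
  qed
  also have "\<dots> = v @ section_at h v (section_at r v u)"
    using Aut_append[OF A(2), of v u] Aut_append[OF hA, of v "section_at r v u"] rv closed
    by (simp add: h_def)
  finally have "u \<in> {w. length w = N \<and> (section_at h v \<circ> section_at r v) w = w}" using u by simp
  then show "0 < num_fixed N (section_at (run p q \<circ> p i) v \<circ> section_at r v)"
    unfolding num_fixed_def h_def[symmetric] by (subst card_gt_0_iff) auto
qed

lemma step_trunc:
  fixes p :: "nat \<Rightarrow> 'x list \<Rightarrow> 'x list"
  assumes p: "\<And>j. j < k \<Longrightarrow> p j \<in> Aut" and p': "\<And>j. j < k \<Longrightarrow> p' j = trunc n (p j)"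
    and l: "fst l < k" and x: "length x \<le> n"
  shows "step p' l x = step p l x"
  using assms by (cases l) (auto simp: trunc_finv trunc_short)

lemma edge_trunc:
  fixes p :: "nat \<Rightarrow> 'x list \<Rightarrow> 'x list"
  assumes p: "\<And>j. j < k \<Longrightarrow> p j \<in> Aut" and p': "\<And>j. j < k \<Longrightarrow> p' j = trunc n (p j)"
    and l: "fst l < k" and x: "length x \<le> n"
  shows "edge p' l x = edge p l x"
  using assms by (cases l) (auto simp: trunc_finv trunc_short)

lemma run_trunc:
  fixes p :: "nat \<Rightarrow> 'x list \<Rightarrow> 'x list"
  assumes p: "\<And>j. j < k \<Longrightarrow> p j \<in> Aut" and p': "\<And>j. j < k \<Longrightarrow> p' j = trunc n (p j)"
    and "word_below k q" and "length x \<le> n"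
  shows "run p' q x = run p q x \<and> avoids p' e q x = avoids p e q x"
  using assms(3,4)
proof (induction q arbitrary: x)
  case (Cons l q)
  have l: "fst l < k" and x: "length x \<le> n" using Cons.prems by auto
  have "length (step p l x) \<le> n"
    using step_Aut[where k = k and f = p, OF p l] x by simp
  then show ?case
    using Cons step_trunc[where k = k and p = p and p' = p', OF p p' l x]
      edge_trunc[where k = k and p = p and p' = p', OF p p' l x] by simp
qed simp

lemma closes_trunc:
  fixes p :: "nat \<Rightarrow> 'x list \<Rightarrow> 'x list"
  assumes p: "\<And>j. j < k \<Longrightarrow> p j \<in> Aut" and p': "\<And>j. j < k \<Longrightarrow> p' j = trunc (length v + N) (p j)"
    and i: "i < k" and q: "word_below k q"
  shows "closes p' i q v N \<longleftrightarrow> closes p i q v N"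
proof -
  have "p' i x = p i x" if "length x \<le> length v + N" for x
    using that p'[OF i] by (simp add: trunc_short)
  moreover have "run p' q x = run p q x \<and> avoids p' e q x = avoids p e q x"
    if "length x \<le> length v + N" for x e
    using run_trunc[where k = k and p = p and p' = p', OF p p' q that] .
  moreover have "length (p i x) = length x" for x using p[OF i] by simp
  ultimately show ?thesis unfolding closes_def by (auto simp: )
qed

context tree_group
begin

definition tuples :: "nat \<Rightarrow> nat \<Rightarrow> (nat \<Rightarrow> 'x list \<Rightarrow> 'x list) set" where
  "tuples k n = (\<Pi>\<^sub>E j\<in>{..<k}. level_quotient G n)"

lemma finite_tuples [simp]: "finite (tuples k n)"
  unfolding tuples_def by (intro finite_PiE) auto

lemma tuples_level_quotient: "p \<in> tuples k n \<Longrightarrow> j < k \<Longrightarrow> p j \<in> level_quotient G n"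
  by (auto simp: tuples_def)

lemma tuples_update: "p \<in> tuples k n \<Longrightarrow> j < k \<Longrightarrow> g \<in> level_quotient G n \<Longrightarrow> p(j := g) \<in> tuples k n"
  by (auto simp: tuples_def PiE_iff extensional_def)

lemma run_level_quotient:
  assumes p: "p \<in> tuples k n" and "word_below k q"
  shows "run p q \<in> level_quotient G n"
  using assms(2)
proof (induction q)
  case (Cons l q)
  then have "step p l \<in> level_quotient G n" using tuples_level_quotient[OF p] by (cases l) (auto intro: level_quotient_inv)
  then have "run p q \<circ> step p l \<in> level_quotient G n" using Cons by (intro level_quotient_comp) auto
  then show ?case by (simp only: run.simps)
qed simp

lemma tuples_translate:
  assumes i: "i < k" and r: "r \<in> level_quotient G n"
  shows "bij_betw (\<lambda>p. p(i := p i \<circ> r)) (tuples k n) (tuples k n)"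
proof (rule bij_betwI[where g = "\<lambda>p. p(i := p i \<circ> finv r)"])
  have translate: "p(i := p i \<circ> s) \<in> tuples k n" if p: "p \<in> tuples k n" and s: "s \<in> level_quotient G n" for p s
    using tuples_update[OF p i level_quotient_comp[OF s tuples_level_quotient[OF p i]]] .
  then show "(\<lambda>p. p(i := p i \<circ> r)) \<in> tuples k n \<rightarrow> tuples k n"
    and "(\<lambda>p. p(i := p i \<circ> finv r)) \<in> tuples k n \<rightarrow> tuples k n"
    using r level_quotient_inv[OF r] by blast+
qed (use level_quotient_Aut[OF r] in \<open>auto simp: comp_assoc\<close>)

end

context fractal_group
begin

text \<open>Count pairs of a tuple and a section \<open>\<kappa>\<close> of the rigid stabilizer whose combination closes. Since
  translation permutes the tuples, each \<open>\<kappa>\<close> contributes equally. Conversely, a given tuple with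
  walk section \<open>h\<close> admits only those \<open>\<kappa>\<close> for which the product of \<open>\<kappa>\<close> and \<open>h\<close> fixes a vertex of
  level \<open>N\<close>, and \<open>\<kappa>\<close> is determined by that product.\<close>

lemma card_closes_le:
  assumes v: "length v = n" and i: "i < k" and q: "word_below k q"
  shows "card (rist_sections v N) * card {p \<in> tuples k (n + N). closes p i q v N}
    \<le> card {h \<in> level_quotient G N. 0 < num_fixed N h} * card (tuples k (n + N))"
proof -
  let ?K = "rist_sections v N" and ?T = "tuples k (n + N)" and ?F = "{h \<in> level_quotient G N. 0 < num_fixed N h}"
  have "\<exists>r. r \<in> level_quotient G (n + N) \<and> rigid_at v r \<and> section_at r v = \<kappa>" if "\<kappa> \<in> ?K" for \<kappa>
  proof -
    from that obtain r where r: "r \<in> G" "rigid_at v r" and \<kappa>: "\<kappa> = trunc N (section_at r v)"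
      by (auto simp: rist_sections_def rist_iff)
    have "trunc (n + N) r \<in> level_quotient G (n + N)" using r by (simp add: level_quotient_def)
    then show ?thesis using r \<kappa> v rigid_at_trunc[OF r(2)] by (metis section_trunc G_Aut)
  qed
  then obtain r where r: "\<And>\<kappa>. \<kappa> \<in> ?K \<Longrightarrow> r \<kappa> \<in> level_quotient G (n + N) \<and> rigid_at v (r \<kappa>) \<and> section_at (r \<kappa>) v = \<kappa>"
    by metis
  define move where "move \<kappa> p = p(i := p i \<circ> r \<kappa>)" for \<kappa> and p :: "nat \<Rightarrow> 'x list \<Rightarrow> 'x list"
  have same_card: "card {p \<in> ?T. closes p i q v N} = card {p \<in> ?T. closes (move \<kappa> p) i q v N}" if \<kappa>: "\<kappa> \<in> ?K" for \<kappa>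
  proof -
    have bij: "bij_betw (move \<kappa>) ?T ?T"
      unfolding move_def using r[OF \<kappa>] i by (intro tuples_translate) auto
    have "bij_betw (move \<kappa>) {p \<in> ?T. closes (move \<kappa> p) i q v N} {p \<in> ?T. closes p i q v N}"
      using bij unfolding bij_betw_def by (auto intro: inj_on_subset)
    from bij_betw_same_card[OF this] show ?thesis by simp
  qed
  have "card ?K * card {p \<in> ?T. closes p i q v N} = (\<Sum>\<kappa>\<in>?K. card {p \<in> ?T. closes p i q v N})"
    by simp
  also have "\<dots> = (\<Sum>\<kappa>\<in>?K. card {p \<in> ?T. closes (move \<kappa> p) i q v N})"
    by (rule sum.cong[OF refl same_card])
  also have "\<dots> = (\<Sum>\<kappa>\<in>?K. \<Sum>p\<in>?T. if closes (move \<kappa> p) i q v N then 1 else 0)"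
    by (intro sum.cong refl) (simp add: sum.If_cases Int_def)
  also have "\<dots> = (\<Sum>p\<in>?T. \<Sum>\<kappa>\<in>?K. if closes (move \<kappa> p) i q v N then 1 else 0)" by (rule sum.swap)
  also have "\<dots> = (\<Sum>p\<in>?T. card {\<kappa> \<in> ?K. closes (move \<kappa> p) i q v N})"
    by (intro sum.cong refl) (simp add: sum.If_cases Int_def)
  also have "\<dots> \<le> (\<Sum>p\<in>?T. card ?F)"
  proof (rule sum_mono)
    fix p assume p: "p \<in> ?T"
    define h where "h = section_at (run p q \<circ> p i) v"
    have pA: "\<And>j. j < k \<Longrightarrow> p j \<in> Aut" using tuples_level_quotient[OF p] level_quotient_Aut by blast
    have hL: "h \<in> level_quotient G N"
      unfolding h_def using run_level_quotient[OF p q] tuples_level_quotient[OF p i] v by (intro section_level_quotient level_quotient_comp)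
    have "(\<lambda>\<kappa>. h \<circ> \<kappa>) ` {\<kappa> \<in> ?K. closes (move \<kappa> p) i q v N} \<subseteq> ?F"
    proof clarify
      fix \<kappa> assume \<kappa>: "\<kappa> \<in> ?K" and cl: "closes (move \<kappa> p) i q v N"
      have "0 < num_fixed N (h \<circ> \<kappa>)"
        using closes_perturb(2)[where k = k and p = p, OF pA _ i q cl[unfolded move_def]] r[OF \<kappa>]
        by (simp add: h_def)
      moreover have "h \<circ> \<kappa> \<in> level_quotient G N" using \<kappa> rist_sections_subset hL by (intro level_quotient_comp) auto
      ultimately show "h \<circ> \<kappa> \<in> level_quotient G N \<and> 0 < num_fixed N (h \<circ> \<kappa>)" by blast
    qed
    moreover have "inj_on (\<lambda>\<kappa>. h \<circ> \<kappa>) {\<kappa> \<in> ?K. closes (move \<kappa> p) i q v N}"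
      using level_quotient_bij_comp_left[OF hL] rist_sections_subset[of v N]
      unfolding bij_betw_def by (blast intro: inj_on_subset)
    ultimately show "card {\<kappa> \<in> ?K. closes (move \<kappa> p) i q v N} \<le> card ?F"
      by (intro card_inj_on_le) auto
  qed
  finally show ?thesis by (simp add: mult.commute)
qed

text \<open>The bounded index of the rigid stabilizer's sections turns the count into a bound by a multiple of
  the fixed-vertex probability.\<close>

lemma closes_density_tendsto_0:
  assumes br: "branch G" and v: "length v = n" and n: "n \<ge> 1" and i: "i < k" and q: "word_below k q"
  shows "(\<lambda>N. card {p \<in> tuples k (n + N). closes p i q v N} / card (tuples k (n + N))) \<longlonglongrightarrow> 0"
proof -
  obtain C where C: "\<And>m. card (level_quotient G m) \<le> C * card (rist_sections v m)"
    using rist_sections_bounded_index[OF br v n] by blast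
  have le: "card {p \<in> tuples k (n + N). closes p i q v N} / card (tuples k (n + N)) \<le> C * fix_prob N" for N
  proof -
    define a b c f K :: real where "a = card {p \<in> tuples k (n + N). closes p i q v N}"
      and "b = card (tuples k (n + N))" and "c = card (level_quotient G N)"
      and "f = card {h \<in> level_quotient G N. 0 < num_fixed N h}" and "K = card (rist_sections v N)"
    have "tuples k (n + N) \<noteq> {}" by (simp add: tuples_def PiE_eq_empty_iff)
    then have b: "0 < b" by (simp add: b_def card_gt_0_iff)
    have c: "0 < c" by (simp add: c_def card_gt_0_iff)
    have cK: "c \<le> C * K" unfolding c_def K_def using C[of N] by (simp flip: of_nat_mult)
    have aK: "K * a \<le> f * b"
      unfolding a_def b_def f_def K_def using card_closes_le[OF v i q, of N]
      by (simp flip: of_nat_mult)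
    have "a * c \<le> a * (C * K)" using cK by (intro mult_left_mono) (auto simp: a_def)
    also have "\<dots> = C * (K * a)" by simp
    also have "\<dots> \<le> C * (f * b)" using aK by (intro mult_left_mono) auto
    finally have "a / b \<le> C * (f / c)" using b c by (simp add: field_simps)
    also have "f / c = fix_prob N"
      unfolding f_def c_def fix_prob_def avg_def by (simp add: sum.If_cases Int_def)
    finally show ?thesis by (simp add: a_def b_def)
  qed
  have "(\<lambda>N. C * fix_prob N) \<longlonglongrightarrow> real C * 0"
    by (intro tendsto_intros fix_prob_tendsto_0)
  then have "(\<lambda>N. C * fix_prob N) \<longlonglongrightarrow> 0" by simp
  then show ?thesis
    by (rule tendsto_sandwich[OF _ _ tendsto_const, rotated 2]) (simp_all add: le)
qed

end

section \<open>Haar measure of level events\<close>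

locale haar_group = fractal_group G for G :: "('x::finite list \<Rightarrow> 'x list) set" +
  fixes \<mu> :: "('x list \<Rightarrow> 'x list) measure"
  assumes haar: "normalized_Haar G \<mu>"
begin

lemma space_haar [simp]: "space \<mu> = G"
  using haar by (simp add: normalized_Haar_def)

lemma prob_space_haar: "prob_space \<mu>"
  using haar by (intro prob_spaceI) (simp add: normalized_Haar_def)

definition cylinder :: "nat \<Rightarrow> ('x list \<Rightarrow> 'x list) \<Rightarrow> ('x list \<Rightarrow> 'x list) set" where
  "cylinder n p = {x \<in> G. trunc n x = p}"

lemma cylinder_eq_coset:
  assumes x: "x \<in> G"
  shows "cylinder n (trunc n x) = (level_stab n #>\<^bsub>tree_Aut\<^esub> x) \<inter> G"
proof
  show "cylinder n (trunc n x) \<subseteq> (level_stab n #>\<^bsub>tree_Aut\<^esub> x) \<inter> G"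
  proof
    fix y assume "y \<in> cylinder n (trunc n x)"
    then have y: "y \<in> G" "trunc n y = trunc n x" by (auto simp: cylinder_def)
    define s where "s = finv x \<circ> y"
    have "y w = x w" if "length w = n" for w
      using fun_cong[OF y(2), of w] that by (simp add: trunc_short)
    then have "s \<in> level_stab n"
      using x y by (simp add: s_def level_stab_def level_def G_Aut)
    moreover have "y = x \<circ> s" using x by (auto simp: s_def G_Aut)
    ultimately show "y \<in> (level_stab n #>\<^bsub>tree_Aut\<^esub> x) \<inter> G"
      using y by (auto simp: r_coset_def)
  qed
  show "(level_stab n #>\<^bsub>tree_Aut\<^esub> x) \<inter> G \<subseteq> cylinder n (trunc n x)"
  proof
    fix y assume y: "y \<in> (level_stab n #>\<^bsub>tree_Aut\<^esub> x) \<inter> G"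
    then obtain s where s: "s \<in> Aut" "\<And>w. length w = n \<Longrightarrow> s w = w" "y = x \<circ> s"
      by (auto simp: r_coset_def level_stab_def level_def)
    have "trunc n y = trunc n x"
      using s x y by (intro trunc_eqI) (auto simp: G_Aut)
    then show "y \<in> cylinder n (trunc n x)" using y by (simp add: cylinder_def)
  qed
qed

lemma sets_cylinder:
  assumes p: "p \<in> level_quotient G n" and n: "n \<ge> 1"
  shows "cylinder n p \<in> sets \<mu>"
proof -
  obtain x where x: "x \<in> G" "p = trunc n x" using p by (auto simp: level_quotient_def)
  have "openin congruence_topology (level_stab n #>\<^bsub>tree_Aut\<^esub> x)"
    unfolding congruence_topology_def using G_Aut[OF x(1)] n
    by (intro topology_generated_by_Basis) blast
  then have "openin (subtopology congruence_topology G) (cylinder n p)"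
    unfolding x(2) cylinder_eq_coset[OF x(1)] openin_subtopology by blast
  then show ?thesis
    using haar by (auto simp: normalized_Haar_def intro: sigma_sets.Basic)
qed

text \<open>The cylinders are the cosets of the level stabilizer: they are translates of one another and
  finitely many of them cover \<open>G\<close>.\<close>

lemma prob_cylinder:
  assumes p: "p \<in> level_quotient G n" and n: "n \<ge> 1"
  shows "measure \<mu> (cylinder n p) = 1 / card (level_quotient G n)"
proof -
  interpret prob_space \<mu> by (rule prob_space_haar)
  have same: "measure \<mu> (cylinder n q) = measure \<mu> (cylinder n id)" if q: "q \<in> level_quotient G n" for q
  proof -
    obtain x where x: "x \<in> G" "q = trunc n x" using q by (auto simp: level_quotient_def)
    have "cylinder n q = x <#\<^bsub>tree_Aut\<^esub> cylinder n id"
    proof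
      show "cylinder n q \<subseteq> x <#\<^bsub>tree_Aut\<^esub> cylinder n id"
      proof
        fix y assume y: "y \<in> cylinder n q"
        have "trunc n (y \<circ> finv x) = trunc n y \<circ> finv (trunc n x)"
          using x by (simp add: trunc_comp trunc_finv G_Aut)
        also have "\<dots> = id" using x y by (simp add: cylinder_def G_Aut)
        finally have "y \<circ> finv x \<in> cylinder n id"
          using x y by (simp add: cylinder_def G_comp G_inv)
        moreover have "y = (y \<circ> finv x) \<circ> x" using x by (auto simp: G_Aut)
        ultimately show "y \<in> x <#\<^bsub>tree_Aut\<^esub> cylinder n id" unfolding l_coset_def by auto
      qed
      show "x <#\<^bsub>tree_Aut\<^esub> cylinder n id \<subseteq> cylinder n q"
        using x by (auto simp: l_coset_def cylinder_def G_comp trunc_comp G_Aut)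
    qed
    then show ?thesis
      using haar x sets_cylinder[OF level_quotient_id n] by (simp add: normalized_Haar_def measure_def)
  qed
  have "1 = measure \<mu> G" using prob_space by simp
  also have "G = (\<Union>q\<in>level_quotient G n. cylinder n q)" by (auto simp: cylinder_def level_quotient_def)
  also have "measure \<mu> (\<Union>q\<in>level_quotient G n. cylinder n q) = (\<Sum>q\<in>level_quotient G n. measure \<mu> (cylinder n q))"
  proof (rule finite_measure_finite_Union)
    show "(\<lambda>q. cylinder n q) ` level_quotient G n \<subseteq> sets \<mu>" using sets_cylinder[OF _ n] by blast
    show "disjoint_family_on (\<lambda>q. cylinder n q) (level_quotient G n)" by (auto simp: disjoint_family_on_def cylinder_def)
  qed simp
  also have "\<dots> = (\<Sum>q\<in>level_quotient G n. measure \<mu> (cylinder n id))" by (rule sum.cong[OF refl same])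
  also have "\<dots> = card (level_quotient G n) * measure \<mu> (cylinder n id)" by simp
  finally have total: "card (level_quotient G n) * measure \<mu> (cylinder n id) = 1" by (rule sym)
  show ?thesis unfolding same[OF p] using total by (simp add: eq_divide_eq mult.commute)
qed

lemma prob_level_event:
  assumes n: "n \<ge> 1" and D: "D \<subseteq> tuples k n"
  defines "S \<equiv> {g \<in> space (\<Pi>\<^sub>M j\<in>{..<k}. \<mu>). (\<lambda>j\<in>{..<k}. trunc n (g j)) \<in> D}"
  shows "S \<in> sets (\<Pi>\<^sub>M j\<in>{..<k}. \<mu>)"
    and "measure (\<Pi>\<^sub>M j\<in>{..<k}. \<mu>) S = card D / card (tuples k n)"
proof -
  let ?P = "\<Pi>\<^sub>M j\<in>{..<k}. \<mu>"
  interpret \<mu>: prob_space \<mu> by (rule prob_space_haar)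
  interpret P: finite_product_prob_space "\<lambda>_. \<mu>" "{..<k}" by standard simp
  define box where "box p = (\<Pi>\<^sub>E j\<in>{..<k}. cylinder n (p j))" for p
  have S: "S = (\<Union>p\<in>D. box p)"
  proof
    show "S \<subseteq> (\<Union>p\<in>D. box p)"
    proof
      fix g assume g: "g \<in> S"
      then have "g \<in> box (\<lambda>j\<in>{..<k}. trunc n (g j))"
        by (auto simp: S_def box_def cylinder_def space_PiM PiE_iff)
      then show "g \<in> (\<Union>p\<in>D. box p)" using g by (auto simp: S_def)
    qed
    show "(\<Union>p\<in>D. box p) \<subseteq> S"
    proof clarify
      fix g p assume p: "p \<in> D" and g: "g \<in> box p"
      have "(\<lambda>j\<in>{..<k}. trunc n (g j)) = p"
        using p g D by (intro ext) (auto simp: box_def cylinder_def tuples_def PiE_iff extensional_def subset_iff)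
      then show "g \<in> S" using p g by (auto simp: S_def box_def cylinder_def space_PiM PiE_iff)
    qed
  qed
  have fin: "finite D" using D by (rule finite_subset) simp
  have box: "box p \<in> sets ?P" "measure ?P (box p) = 1 / card (tuples k n)" if "p \<in> D" for p
  proof -
    have p: "p j \<in> level_quotient G n" if "j < k" for j
      using \<open>p \<in> D\<close> D that tuples_level_quotient by blast
    show "box p \<in> sets ?P"
      unfolding box_def by (intro sets_PiM_I_finite) (auto intro: sets_cylinder[OF p n])
    have "measure ?P (box p) = (\<Prod>j\<in>{..<k}. measure \<mu> (cylinder n (p j)))"
      unfolding box_def by (intro P.prob_times) (auto intro: sets_cylinder[OF p n])
    also have "\<dots> = (\<Prod>j\<in>{..<k}. 1 / card (level_quotient G n))"
      by (intro prod.cong refl) (auto intro: prob_cylinder[OF p n])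
    also have "\<dots> = 1 / card (tuples k n)"
      by (simp add: tuples_def card_PiE power_one_over)
    finally show "measure ?P (box p) = 1 / card (tuples k n)" .
  qed
  show "S \<in> sets ?P" unfolding S using fin box by (intro sets.finite_UN) auto
  have "box p \<inter> box p' = {}" if "p \<in> D" "p' \<in> D" "p \<noteq> p'" for p p'
  proof (rule ccontr)
    assume "box p \<inter> box p' \<noteq> {}"
    then obtain g where "g \<in> box p" "g \<in> box p'" by blast
    then have "p j = p' j" if "j < k" for j
      using that by (auto simp: box_def cylinder_def PiE_iff)
    moreover have "p \<in> extensional {..<k}" "p' \<in> extensional {..<k}"
      using \<open>p \<in> D\<close> \<open>p' \<in> D\<close> D by (auto simp: tuples_def PiE_iff)
    ultimately have "p = p'" by (intro extensionalityI[where A = "{..<k}"]) auto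
    with \<open>p \<noteq> p'\<close> show False by simp
  qed
  then have "measure ?P (\<Union>p\<in>D. box p) = (\<Sum>p\<in>D. measure ?P (box p))"
    using fin box by (intro P.finite_measure_finite_Union) (auto simp: disjoint_family_on_def)
  then show "measure ?P S = card D / card (tuples k n)" unfolding S using box by simp
qed

text \<open>The event is visible on level \<open>length v + N\<close>, so its Haar probability is the counting density,
  which tends to 0 as \<open>N\<close> grows.\<close>

lemma AE_not_closes:
  assumes br: "branch G" and v: "v \<noteq> []" and i: "i < k" and q: "word_below k q"
  shows "AE g in (\<Pi>\<^sub>M j\<in>{..<k}. \<mu>). \<exists>N. \<not> closes g i q v N"
proof -
  let ?P = "\<Pi>\<^sub>M j\<in>{..<k}. \<mu>" and ?n = "length v"
  interpret \<mu>: prob_space \<mu> by (rule prob_space_haar)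
  interpret P: finite_product_prob_space "\<lambda>_. \<mu>" "{..<k}" by standard simp
  have n: "?n \<ge> 1" using v by (cases v) auto
  define B where "B N = {g \<in> space ?P. closes g i q v N}" for N
  define D where "D N = {p \<in> tuples k (?n + N). closes p i q v N}" for N
  have B: "B N = {g \<in> space ?P. (\<lambda>j\<in>{..<k}. trunc (?n + N) (g j)) \<in> D N}" for N
    unfolding B_def
  proof (rule Collect_cong, rule conj_cong[OF refl])
    fix g assume "g \<in> space ?P"
    then have g: "\<And>j. j < k \<Longrightarrow> g j \<in> G" by (auto simp: space_PiM PiE_iff)
    have "(\<lambda>j\<in>{..<k}. trunc (?n + N) (g j)) \<in> tuples k (?n + N)"
      using g by (auto simp: tuples_def level_quotient_def)
    moreover have "closes (\<lambda>j\<in>{..<k}. trunc (?n + N) (g j)) i q v N \<longleftrightarrow> closes g i q v N"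
      by (rule closes_trunc[where k = k and p = g, OF _ _ i q]) (use g in \<open>auto simp: G_Aut\<close>)
    ultimately show "closes g i q v N \<longleftrightarrow> (\<lambda>j\<in>{..<k}. trunc (?n + N) (g j)) \<in> D N"
      by (simp add: D_def)
  qed
  have D: "D N \<subseteq> tuples k (?n + N)" for N by (auto simp: D_def)
  have n': "?n + N \<ge> 1" for N using n by simp
  have sets: "B N \<in> sets ?P" and meas: "measure ?P (B N) = card (D N) / card (tuples k (?n + N))" for N
    unfolding B by (rule prob_level_event[OF n' D])+
  have "(\<lambda>N. measure ?P (B N)) \<longlonglongrightarrow> 0"
    unfolding meas D_def by (rule closes_density_tendsto_0[OF br refl n i q])
  moreover have "measure ?P (\<Inter>N. B N) \<le> measure ?P (B N)" for N
    using sets by (intro P.finite_measure_mono) auto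
  ultimately have "measure ?P (\<Inter>N. B N) \<le> 0"
    by (intro LIMSEQ_le_const[of _ 0]) auto
  then have "emeasure ?P (\<Inter>N. B N) = 0" by (simp add: P.emeasure_eq_measure measure_le_0_iff)
  moreover have "(\<Inter>N. B N) \<in> sets ?P" using sets by auto
  ultimately show ?thesis by (intro AE_I[where N = "\<Inter>N. B N"]) (auto simp: B_def)
qed

end

section \<open>Forests of bridges admit no invariant mean\<close>

text \<open>Adjacency in the orbital graph after deleting the edges in \<open>E\<close>.\<close>

definition link :: "(nat \<Rightarrow> 'a \<Rightarrow> 'a) \<Rightarrow> nat \<Rightarrow> (nat \<times> 'a) set \<Rightarrow> 'a \<Rightarrow> 'a \<Rightarrow> bool" where
  "link f k E x y \<longleftrightarrow> (\<exists>l. fst l < k \<and> edge f l x \<notin> E \<and> step f l x = y)"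

lemma link_mono:
  assumes "E \<subseteq> E'" and "(link f k E')\<^sup>*\<^sup>* x y"
  shows "(link f k E)\<^sup>*\<^sup>* x y"
proof -
  have "link f k E' \<le> link f k E"
    using assms(1) unfolding link_def by (intro predicate2I) blast
  from rtranclp_mono[OF this] assms(2) show ?thesis by blast
qed

lemma reachable_word:
  assumes "(link f k {e})\<^sup>*\<^sup>* x y"
  shows "\<exists>q. word_below k q \<and> avoids f e q x \<and> run f q x = y"
  using assms
proof (induction rule: converse_rtranclp_induct)
  case base
  show ?case by (rule exI[of _ "[]"]) simp
next
  case (step x z)
  then obtain l q where "fst l < k" "edge f l x \<noteq> e" "step f l x = z"
    and "word_below k q" "avoids f e q z" "run f q z = y"
    by (auto simp: link_def)
  then show ?case by (intro exI[of _ "l # q"]) simp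
qed

context
  fixes f :: "nat \<Rightarrow> 'a \<Rightarrow> 'a" and k :: nat
  assumes bij: "\<And>j. j < k \<Longrightarrow> bij (f j)"
begin

lemma bij_finv_apply: "j < k \<Longrightarrow> finv (f j) (f j x) = x" "j < k \<Longrightarrow> f j (finv (f j) x) = x"
  using bij[of j] by (simp_all add: bij_is_inj bij_is_surj surj_f_inv_f)

lemma link_sym:
  assumes "link f k E x y"
  shows "link f k E y x"
proof -
  obtain j b where l: "j < k" "edge f (j, b) x \<notin> E" "step f (j, b) x = y"
    using assms by (auto simp: link_def)
  then have "edge f (j, \<not> b) y \<notin> E \<and> step f (j, \<not> b) y = x"
    by (cases b) (auto simp: bij_finv_apply)
  then show ?thesis using l(1) unfolding link_def by (intro exI[of _ "(j, \<not> b)"]) simp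
qed

lemma reachable_sym: "(link f k E)\<^sup>*\<^sup>* x y \<Longrightarrow> (link f k E)\<^sup>*\<^sup>* y x"
  by (rule sympD[OF symp_rtranclp]) (auto intro: sympI link_sym)

lemma edge_incident:
  assumes "fst l < k" and "edge f l a = edge f l' x"
  shows "a = x \<or> step f l a = x"
proof -
  obtain j b b' where l: "l = (j, b)" "l' = (j, b')" using assms(2) by (cases l; cases l') auto
  then have j: "j < k" and eq: "(if b then a else finv (f j) a) = (if b' then x else finv (f j) x)"
    using assms by auto
  have "f j (finv (f j) y) = y" for y by (rule bij_finv_apply(2)[OF j])
  then show ?thesis using eq unfolding l(1) by (cases b; cases b'; simp) metis
qed

text \<open>After its last visit to \<open>x\<close>, a path from \<open>x\<close> to \<open>\<rho>\<close> uses at most one of two distinct edges at \<open>x\<close>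
  and avoids the other. Induction from the end of the path finds that last visit.\<close>

lemma reachable_avoiding_one_of_two:
  assumes ne: "edge f l x \<noteq> edge f l' x" and reach: "(link f k {})\<^sup>*\<^sup>* x \<rho>"
  shows "(link f k {edge f l x})\<^sup>*\<^sup>* x \<rho> \<or> (link f k {edge f l' x})\<^sup>*\<^sup>* x \<rho>"
proof -
  let ?e = "edge f l x" and ?e' = "edge f l' x"
  let ?goal = "(link f k {?e})\<^sup>*\<^sup>* x \<rho> \<or> (link f k {?e'})\<^sup>*\<^sup>* x \<rho>"
  have last_visit: ?goal
    if "(link f k {?e, ?e'})\<^sup>*\<^sup>* b \<rho>" "fst c < k" "edge f c a \<in> {?e, ?e'}" "step f c a = b" for a b c
  proof -
    have mono: "(link f k {?e})\<^sup>*\<^sup>* b \<rho>" "(link f k {?e'})\<^sup>*\<^sup>* b \<rho>"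
      by (rule link_mono[OF _ that(1)]; simp)+
    have "a = x \<or> b = x" using that edge_incident by blast
    then show ?goal
    proof
      assume "a = x"
      have "edge f c x \<noteq> ?e \<or> edge f c x \<noteq> ?e'" using ne by metis
      moreover have "fst c < k" "step f c x = b" using that(2,4) \<open>a = x\<close> by simp_all
      ultimately have "link f k {?e} x b \<or> link f k {?e'} x b"
        unfolding link_def by blast
      then show ?goal using mono by (blast intro: converse_rtranclp_into_rtranclp)
    qed (use mono in blast)
  qed
  have "(link f k {?e, ?e'})\<^sup>*\<^sup>* a \<rho> \<or> ?goal" if "(link f k {})\<^sup>*\<^sup>* a \<rho>" for a
    using that
  proof (induction rule: converse_rtranclp_induct)
    case (step a b)
    then obtain c where c: "fst c < k" "step f c a = b" by (auto simp: link_def)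
    show ?case
    proof (cases "edge f c a \<in> {?e, ?e'}")
      case True
      then show ?thesis using step.IH last_visit c by blast
    next
      case False
      then have "link f k {?e, ?e'} a b" using c unfolding link_def by blast
      then show ?thesis using step.IH by (blast intro: converse_rtranclp_into_rtranclp)
    qed
  qed simp
  from this[OF reach] show ?thesis using link_mono[of "{?e}" "{?e, ?e'}" f k x \<rho>] by auto
qed

text \<open>\<open>W l\<close> collects the points at which the letter \<open>l\<close> starts the path towards the root, detected by
  the fact that deleting the edge of \<open>l\<close> cuts them off from it. Two such letters at the same point
  would cut it off along two different edges, so the classes are disjoint. As deleting a bridge cuts
  one of its ends off from the root, every point outside \<open>W (j, True)\<close> is mapped by the \<open>j\<close>-th
  generator into \<open>W (j, False)\<close>.\<close>

lemma bridges_no_invariant_mean: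
  fixes m :: "'a set \<Rightarrow> real"
  assumes k: "2 \<le> k"
    and bridge: "\<And>i x q. i < k \<Longrightarrow> word_below k q \<Longrightarrow> avoids f (i, x) q (f i x) \<Longrightarrow> run f q (f i x) \<noteq> x"
    and nonneg: "\<And>A. 0 \<le> m A" and total: "m UNIV = 1"
    and add: "\<And>A B. A \<inter> B = {} \<Longrightarrow> m (A \<union> B) = m A + m B"
    and inv: "\<And>j A. j < k \<Longrightarrow> m (f j ` A) = m A"
  shows False
proof -
  define root where "root x = (SOME y. (link f k {})\<^sup>*\<^sup>* x y)" for x
  have root: "(link f k {})\<^sup>*\<^sup>* x (root x)" for x
    unfolding root_def by (rule someI[of _ x]) simp
  have root_eq: "root x = root y" if "link f k {} x y" for x y
  proof -
    have "(link f k {})\<^sup>*\<^sup>* x = (link f k {})\<^sup>*\<^sup>* y"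
      using that link_sym[OF that] by (auto intro!: ext intro: converse_rtranclp_into_rtranclp)
    then show ?thesis by (simp add: root_def)
  qed
  define W where "W l = {x. \<not> (link f k {edge f l x})\<^sup>*\<^sup>* x (root x)}" for l
  have cover: "f j x \<in> W (j, False)" if j: "j < k" and x: "x \<notin> W (j, True)" for j x
  proof (rule ccontr)
    let ?R = "(link f k {(j, x)})\<^sup>*\<^sup>*"
    assume "f j x \<notin> W (j, False)"
    then have "?R (f j x) (root (f j x))" using j by (simp add: W_def bij_finv_apply)
    moreover have "link f k {} x (f j x)"
      using j unfolding link_def by (intro exI[of _ "(j, True)"]) simp
    then have "root (f j x) = root x" using root_eq by metis
    moreover have "?R x (root x)" using x by (simp add: W_def)
    ultimately have "?R (f j x) x" by (metis reachable_sym rtranclp_trans)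
    then show False using reachable_word bridge[OF j] by metis
  qed
  have disjoint: "W l \<inter> W l' = {}" if l: "fst l < k" "fst l' < k" "l \<noteq> l'" for l l'
  proof (rule ccontr)
    assume "W l \<inter> W l' \<noteq> {}"
    then obtain x where x: "x \<in> W l" "x \<in> W l'" by blast
    \<comment> \<open>A loop is closed by the empty walk, so it is not a bridge.\<close>
    have no_loop: "f j x \<noteq> x" if "j < k" for j using bridge[OF that, of "[]" x] by simp
    have "edge f l x \<noteq> edge f l' x"
    proof
      assume eq: "edge f l x = edge f l' x"
      obtain j b b' where jb: "l = (j, b)" "l' = (j, b')" using eq by (cases l; cases l') auto
      then have "finv (f j) x = x" using eq l(3) by (cases b; cases b') auto
      then have "f j x = x" using bij_finv_apply(2)[of j x] l(1) jb by simp
      then show False using no_loop[of j] l(1) jb by simp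
    qed
    from reachable_avoiding_one_of_two[OF this root] show False using x by (simp add: W_def)
  qed
  have mono: "m A \<le> m B" if "A \<subseteq> B" for A B
  proof -
    have "m (A \<union> (B - A)) = m A + m (B - A)" by (rule add) auto
    moreover have "A \<union> (B - A) = B" using that by auto
    ultimately show ?thesis using nonneg[of "B - A"] by simp
  qed
  have pair: "1 \<le> m (W (j, True)) + m (W (j, False))" if j: "j < k" for j
  proof -
    have "1 = m (W (j, True) \<union> - W (j, True))" using total by simp
    also have "\<dots> = m (W (j, True)) + m (- W (j, True))" by (rule add) auto
    also have "m (- W (j, True)) = m (f j ` (- W (j, True)))" using inv[OF j] by simp
    also have "\<dots> \<le> m (W (j, False))" using cover[OF j] by (intro mono) auto
    finally show ?thesis by simp
  qed
  have k01: "0 < k" "1 < k" using k by auto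
  define A where "A j = W (j, True) \<union> W (j, False)" for j
  have mA: "m (A j) = m (W (j, True)) + m (W (j, False))" if "j < k" for j
    unfolding A_def using that by (intro add disjoint) auto
  have "A 0 \<inter> A 1 = {}"
    unfolding A_def using disjoint[of "(0, _)" "(1, _)"] k01 by (auto simp: Int_Un_distrib Int_Un_distrib2)
  then have "m (A 0 \<union> A 1) = m (A 0) + m (A 1)" by (rule add)
  moreover have "m (A 0 \<union> A 1) \<le> 1" unfolding total[symmetric] by (rule mono) simp
  ultimately show False
    using pair[OF k01(1)] pair[OF k01(2)] mA[OF k01(1)] mA[OF k01(2)] by linarith
qed

end

section \<open>Passing to the boundary\<close>

definition prefix_upto :: "nat \<Rightarrow> (nat \<Rightarrow> 'x) \<Rightarrow> 'x list" where
  "prefix_upto n \<xi> = map \<xi> [0..<n]"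

lemma length_prefix_upto [simp]: "length (prefix_upto n \<xi>) = n"
  by (simp add: prefix_upto_def)

lemma prefix_upto_add: "prefix_upto (n + m) \<xi> = prefix_upto n \<xi> @ map \<xi> [n..<n + m]"
  by (simp add: prefix_upto_def upt_add_eq_append[of 0])

lemma take_prefix_upto: "n \<le> m \<Longrightarrow> take n (prefix_upto m \<xi>) = prefix_upto n \<xi>"
  by (simp add: prefix_upto_def take_map)

lemma prefix_upto_eqI: "(\<And>n. prefix_upto n \<xi> = prefix_upto n \<eta>) \<Longrightarrow> \<xi> = \<eta>"
proof
  fix n assume "\<And>n. prefix_upto n \<xi> = prefix_upto n \<eta>"
  from this[of "Suc n"] show "\<xi> n = \<eta> n" by (simp add: prefix_upto_def)
qed

lemma prefix_boundary_act:
  assumes g: "g \<in> Aut"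
  shows "prefix_upto n (boundary_act g \<xi>) = g (prefix_upto n \<xi>)"
proof (rule nth_equalityI)
  show "length (prefix_upto n (boundary_act g \<xi>)) = length (g (prefix_upto n \<xi>))" using g by simp
  fix i assume "i < length (prefix_upto n (boundary_act g \<xi>))"
  then have i: "i < n" by simp
  then obtain m where m: "n = Suc i + m" using less_iff_Suc_add[of i n] by auto
  have "g (prefix_upto n \<xi>) = g (prefix_upto (Suc i) \<xi>) @ section_at g (prefix_upto (Suc i) \<xi>) (map \<xi> [Suc i..<n])"
    unfolding m prefix_upto_add by (rule Aut_append[OF g])
  moreover have "i < length (g (prefix_upto (Suc i) \<xi>))" using g by simp
  ultimately have "g (prefix_upto n \<xi>) ! i = g (prefix_upto (Suc i) \<xi>) ! i" by (simp only: nth_append if_True)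
  moreover have "prefix_upto n (boundary_act g \<xi>) ! i = boundary_act g \<xi> i"
    using i by (simp add: prefix_upto_def)
  ultimately show "prefix_upto n (boundary_act g \<xi>) ! i = g (prefix_upto n \<xi>) ! i"
    by (simp add: boundary_act_def prefix_upto_def)
qed

lemma boundary_act_inverse:
  assumes g: "g \<in> Aut"
  shows "boundary_act (finv g) (boundary_act g \<xi>) = \<xi>" "boundary_act g (boundary_act (finv g) \<xi>) = \<xi>"
  using g by (auto intro!: prefix_upto_eqI simp: prefix_boundary_act)

lemma bij_boundary_act: "g \<in> Aut \<Longrightarrow> bij (boundary_act g)"
  using boundary_act_inverse by (metis bijI')

lemma finv_boundary_act: "g \<in> Aut \<Longrightarrow> finv (boundary_act g) = boundary_act (finv g)"
  by (rule inv_equality) (simp_all add: boundary_act_inverse)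

context
  fixes g :: "nat \<Rightarrow> 'x list \<Rightarrow> 'x list" and k :: nat
  assumes g: "\<And>j. j < k \<Longrightarrow> g j \<in> Aut"
begin

lemma prefix_step: "fst l < k \<Longrightarrow> prefix_upto n (step (\<lambda>j. boundary_act (g j)) l \<xi>) = step g l (prefix_upto n \<xi>)"
  using g by (cases l) (simp add: finv_boundary_act prefix_boundary_act)

lemma prefix_run: "word_below k q \<Longrightarrow> prefix_upto n (run (\<lambda>j. boundary_act (g j)) q \<xi>) = run g q (prefix_upto n \<xi>)"
  by (induction q arbitrary: \<xi>) (simp_all add: prefix_step)

text \<open>Distinct boundary points have distinct prefixes from some level on, so avoiding an edge is
  visible on all deep levels.\<close>

lemma edge_eventually_avoided:
  assumes l: "fst l < k" and ne: "edge (\<lambda>j. boundary_act (g j)) l \<eta> \<noteq> (i, \<xi>)"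
  shows "\<exists>n0. \<forall>n\<ge>n0. edge g l (prefix_upto n \<eta>) \<noteq> (i, prefix_upto n \<xi>)"
proof -
  obtain j b where lb: "l = (j, b)" by (cases l) auto
  define \<zeta> where "\<zeta> = (if b then \<eta> else boundary_act (finv (g j)) \<eta>)"
  have A: "g j \<in> Aut" using g l lb by simp
  have edge: "edge g l (prefix_upto n \<eta>) = (j, prefix_upto n \<zeta>)" for n
    using A lb by (simp add: \<zeta>_def prefix_boundary_act)
  show ?thesis
  proof (cases "j = i")
    case True
    then have "\<zeta> \<noteq> \<xi>" using ne lb A by (auto simp: \<zeta>_def finv_boundary_act)
    then obtain n0 where "prefix_upto n0 \<zeta> \<noteq> prefix_upto n0 \<xi>" using prefix_upto_eqI by blast
    then have "prefix_upto n \<zeta> \<noteq> prefix_upto n \<xi>" if "n \<ge> n0" for n using take_prefix_upto[OF that] by metis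
    then show ?thesis unfolding edge by blast
  qed (simp add: edge)
qed

lemma eventually_avoids:
  assumes "word_below k q" and "avoids (\<lambda>j. boundary_act (g j)) (i, \<xi>) q \<eta>"
  shows "\<exists>n0. \<forall>n\<ge>n0. avoids g (i, prefix_upto n \<xi>) q (prefix_upto n \<eta>)"
  using assms
proof (induction q arbitrary: \<eta>)
  case (Cons l q)
  then have l: "fst l < k" and q: "word_below k q" by auto
  obtain n1 where n1: "\<And>n. n \<ge> n1 \<Longrightarrow> edge g l (prefix_upto n \<eta>) \<noteq> (i, prefix_upto n \<xi>)"
    using edge_eventually_avoided[OF l] Cons.prems(2) by (metis avoids.simps(2))
  obtain n2 where n2: "\<And>n. n \<ge> n2 \<Longrightarrow> avoids g (i, prefix_upto n \<xi>) q (prefix_upto n (step (\<lambda>j. boundary_act (g j)) l \<eta>))"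
    using Cons.IH[OF q] Cons.prems(2) by (metis avoids.simps(2))
  have "avoids g (i, prefix_upto n \<xi>) (l # q) (prefix_upto n \<eta>)" if "n \<ge> max n1 n2" for n
    using n1[of n] n2[of n] that by (simp add: prefix_step[OF l])
  then show ?case by blast
qed simp

lemma boundary_cycle_closes:
  assumes i: "i < k" and q: "word_below k q"
    and av: "avoids (\<lambda>j. boundary_act (g j)) (i, \<xi>) q (boundary_act (g i) \<xi>)"
    and cycle: "run (\<lambda>j. boundary_act (g j)) q (boundary_act (g i) \<xi>) = \<xi>"
  shows "\<exists>v. v \<noteq> [] \<and> (\<forall>N. closes g i q v N)"
proof -
  obtain n0 where n0: "\<And>n. n \<ge> n0 \<Longrightarrow> avoids g (i, prefix_upto n \<xi>) q (prefix_upto n (boundary_act (g i) \<xi>))"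
    using eventually_avoids[OF q av] by blast
  \<comment> \<open>Positive, because fractality and branching speak of levels below the root.\<close>
  define n where "n = max n0 1"
  have closed: "run g q (g i (prefix_upto m \<xi>)) = prefix_upto m \<xi>" for m
    using prefix_run[OF q, of m "boundary_act (g i) \<xi>"] cycle by (simp add: prefix_boundary_act g i)
  have "closes g i q (prefix_upto n \<xi>) N" for N
    unfolding closes_def
  proof (intro conjI exI)
    show "avoids g (i, prefix_upto n \<xi>) q (g i (prefix_upto n \<xi>))"
      using n0[of n] by (simp add: n_def prefix_boundary_act g i)
    show "run g q (g i (prefix_upto n \<xi> @ map \<xi> [n..<n + N])) = prefix_upto n \<xi> @ map \<xi> [n..<n + N]"
      using closed[of "n + N"] by (simp only: prefix_upto_add)
  qed (simp_all add: closed)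
  moreover have "prefix_upto n \<xi> \<noteq> []" by (simp add: prefix_upto_def n_def)
  ultimately show ?thesis by blast
qed

end

section \<open>Random subgroups act non-amenably\<close>

theorem corollary2:
  fixes G :: "('x::finite list \<Rightarrow> 'x list) set"
    and \<mu> :: "('x list \<Rightarrow> 'x list) measure"
    and k :: nat
  assumes "CARD('x) \<ge> 2"
    and "subgroup G tree_Aut"
    and "closedin congruence_topology G"
    and "super_strongly_fractal G"
    and "branch G"
    and "normalized_Haar G \<mu>"
    and "k \<ge> 2"
  shows "AE g in (\<Pi>\<^sub>M i\<in>{..<k}. \<mu>).
    \<not> amenable_action (generate tree_Aut (g ` {..<k})) boundary_act (UNIV :: (nat \<Rightarrow> 'x) set)"
proof -
  interpret haar_group G \<mu>
    by (intro haar_group.intro fractal_group.intro tree_group.intro fractal_group_axioms.intro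
        haar_group_axioms.intro assms)
  have "AE g in (\<Pi>\<^sub>M i\<in>{..<k}. \<mu>). \<forall>i q v. i < k \<longrightarrow> word_below k q \<longrightarrow> v \<noteq> [] \<longrightarrow> (\<exists>N. \<not> closes g i q v N)"
    unfolding AE_all_countable
  proof (intro allI)
    fix i q and v :: "'x list"
    show "AE g in (\<Pi>\<^sub>M i\<in>{..<k}. \<mu>). i < k \<longrightarrow> word_below k q \<longrightarrow> v \<noteq> [] \<longrightarrow> (\<exists>N. \<not> closes g i q v N)"
      using AE_not_closes[OF \<open>branch G\<close>, of v i k q]
      by (cases "i < k \<and> word_below k q \<and> v \<noteq> []") auto
  qed
  then show ?thesis
  proof (rule AE_mp, intro AE_I2 impI notI)
    fix g
    assume gP: "g \<in> space (\<Pi>\<^sub>M i\<in>{..<k}. \<mu>)"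
      and open_walks: "\<forall>i q v. i < k \<longrightarrow> word_below k q \<longrightarrow> v \<noteq> [] \<longrightarrow> (\<exists>N. \<not> closes g i q v N)"
      and am: "amenable_action (generate tree_Aut (g ` {..<k})) boundary_act (UNIV :: (nat \<Rightarrow> 'x) set)"
    have g: "\<And>j. j < k \<Longrightarrow> g j \<in> Aut" using gP by (auto simp: space_PiM PiE_iff G_Aut)
    from am obtain m :: "(nat \<Rightarrow> 'x) set \<Rightarrow> real" where m: "\<forall>A. 0 \<le> m A" "m UNIV = 1"
        "\<forall>A B. A \<inter> B = {} \<longrightarrow> m (A \<union> B) = m A + m B"
      and inv: "\<forall>h\<in>generate tree_Aut (g ` {..<k}). \<forall>A. m (boundary_act h ` A) = m A"
      unfolding amenable_action_def by auto
    show False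
    proof (rule bridges_no_invariant_mean[where f = "\<lambda>j. boundary_act (g j)" and k = k and m = m])
      show "bij (boundary_act (g j))" if "j < k" for j by (rule bij_boundary_act[OF g[OF that]])
      show "run (\<lambda>j. boundary_act (g j)) q (boundary_act (g i) \<xi>) \<noteq> \<xi>"
        if "i < k" "word_below k q" "avoids (\<lambda>j. boundary_act (g j)) (i, \<xi>) q (boundary_act (g i) \<xi>)" for i \<xi> q
        using boundary_cycle_closes[where g = g and k = k, OF g that] open_walks that by blast
      show "m (boundary_act (g j) ` A) = m A" if "j < k" for j A
        using inv generate.incl[of "g j" "g ` {..<k}" tree_Aut] that by auto
    qed (use m \<open>k \<ge> 2\<close> in auto)
  qed
qed

end
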